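(* Let $n=4k+\alpha$ with $k$ a positive integer and $\alpha\in\{0,1,2,3\}$, and let $G$ be a uniformly most reliable graph in ${\cal H}(n,n+2)$. Then $G$ is isomorphic to the graph of type A with vector of c-path lengths $(k,k,k,k)$ if $\alpha=0$; $(k+1,k,k,k)$ if $\alpha=1$; $(k+1,k,k+1,k)$ if $\alpha=2$; $(k+1,k+1,k+1,k)$ if $\alpha=3$.
   Context: All graphs are finite and simple. ${\cal H}(n,m)$ is the set of (pairwise non-isomorphic) hamiltonian graphs with $n$ vertices and $m$ edges. For a connected graph $G=(V,E)$ with $m$ edges, $\mathrm{Rel}(G,p)=\sum_{i=0}^m N_i p^i(1-p)^{m-i}$, where $N_i$ is the number of subsets $N\subseteq E$ with $|N|=i$ such that $(V,N)$ is connected (the probability that $G$ stays connected when each edge independently survives with probability $p$). $G$ is uniformly most reliable in ${\cal H}(n,m)$ if $G\in{\cal H}(n,m)$ and $\mathrm{Rel}(G,p)\geq\mathrm{Rel}(H,p)$ for all $p\in[0,1]$ and all $H\in{\cal H}(n,m)$. Given nonnegative integers $x_1,x_2,x_3,x_4$ summing to $n$, the graph of type A with vector of c-path lengths $(x_1,x_2,x_3,x_4)$ is obtained from the cycle with vertices $0,1,\dots,n-1$ (in this cyclic order) by adding the two crossing chords $\{0,x_1+x_2\}$ and $\{x_1,x_1+x_2+x_3\}$ (labels modulo $n$); its chord endpoints split the hamiltonian cycle into consecutive paths of lengths $x_1,x_2,x_3,x_4$. *)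

theory Defs
  imports Complex_Main
begin

type_synonym 'a ugraph = "'a set \<times> 'a set set"

abbreviation verts :: "'a ugraph \<Rightarrow> 'a set" where
  "verts G \<equiv> fst G"

abbreviation edges :: "'a ugraph \<Rightarrow> 'a set set" where
  "edges G \<equiv> snd G"

definition simple_graph :: "'a ugraph \<Rightarrow> bool" where
  "simple_graph G \<longleftrightarrow> finite (verts G) \<and> (\<forall>e\<in>edges G. e \<subseteq> verts G \<and> card e = 2)"

definition connected_graph :: "'a ugraph \<Rightarrow> bool" where
  "connected_graph G \<longleftrightarrow> verts G \<noteq> {} \<and>
     (\<forall>u\<in>verts G. \<forall>v\<in>verts G. (u, v) \<in> {(x, y). {x, y} \<in> edges G}\<^sup>*)"

text \<open>A hamiltonian cycle is given by the list of the vertices in the order in which it visits them;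
  a cycle in a simple graph has at least three vertices.\<close>

definition hamiltonian :: "'a ugraph \<Rightarrow> bool" where
  "hamiltonian G \<longleftrightarrow> (\<exists>vs. distinct vs \<and> set vs = verts G \<and> 3 \<le> length vs \<and>
     (\<forall>i<length vs. {vs ! i, vs ! (Suc i mod length vs)} \<in> edges G))"

definition graph_iso :: "'a ugraph \<Rightarrow> 'b ugraph \<Rightarrow> bool" where
  "graph_iso G H \<longleftrightarrow>
     (\<exists>f. bij_betw f (verts G) (verts H) \<and> (\<lambda>e. f ` e) ` edges G = edges H)"

text \<open>The class is given by all labelled graphs on vertices of type \<open>'a\<close> instead of one representative
  of each isomorphism type. As soon as \<open>'a\<close> has at least \<open>n\<close> elements, every isomorphism type with
  \<open>n\<close> vertices occurs.\<close>

definition hamiltonian_graphs :: "nat \<Rightarrow> nat \<Rightarrow> 'a ugraph set" where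
  "hamiltonian_graphs n m =
     {G. simple_graph G \<and> hamiltonian G \<and> card (verts G) = n \<and> card (edges G) = m}"

definition connected_spanning :: "'a ugraph \<Rightarrow> nat \<Rightarrow> nat" where
  "connected_spanning G i =
     card {N. N \<subseteq> edges G \<and> card N = i \<and> connected_graph (verts G, N)}"

definition Rel :: "'a ugraph \<Rightarrow> real \<Rightarrow> real" where
  "Rel G p =
     (\<Sum>i=0..card (edges G).
        real (connected_spanning G i) * p ^ i * (1 - p) ^ (card (edges G) - i))"

definition uniformly_most_reliable :: "nat \<Rightarrow> nat \<Rightarrow> 'a ugraph \<Rightarrow> bool" where
  "uniformly_most_reliable n m G \<longleftrightarrow>
     G \<in> hamiltonian_graphs n m \<and>
     (\<forall>p\<in>{0..1}. \<forall>H\<in>(hamiltonian_graphs n m :: 'a ugraph set). Rel H p \<le> Rel G p)"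

definition type_A :: "nat \<times> nat \<times> nat \<times> nat \<Rightarrow> nat ugraph" where
  "type_A = (\<lambda>(x1, x2, x3, x4).
     let n = x1 + x2 + x3 + x4 in
       ({..<n},
        {{i, Suc i mod n} | i. i < n} \<union>
        {{0, (x1 + x2) mod n}, {x1 mod n, (x1 + x2 + x3) mod n}}))"

end

theory Submission
  imports Defs
begin

text \<open>As \<open>p\<close> tends to \<open>0\<close>, the reliability is dominated by the number of spanning trees, so a uniformly
  most reliable graph maximizes that number. A hamiltonian graph with \<open>n + 2\<close> edges is a cycle with two
  chords; classify the cycle edges by the pair of chord arcs that contain them, with class sizes
  \<open>x1, x2, x3, x4\<close> (one of them is \<open>0\<close> if the chords do not cross). A set of at most three deleted
  cycle edges leaves the graph connected iff each two of them are separated by the arc of a remaining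
  chord, so the number of spanning trees is
  \<open>n + (x1 + x2) (x3 + x4) + (x2 + x3) (x1 + x4) + e\<^sub>3(x1, x2, x3, x4)\<close> whether or not the chords cross.
  Its maximizers have only positive class sizes, which forces the chords to cross, and they are the
  rotations of the claimed vector.\<close>

section \<open>Connectivity by cuts, and the least number of edges\<close>

text \<open>Reachability from \<open>u\<close> is the least property that holds at \<open>u\<close>
  and is preserved along edges, so quantifying over all such properties replaces paths. In this form
  no path has to be built when edges of a cycle with chords are deleted.\<close>

lemma connected_graph_iff_cut:
  "connected_graph (V, N) \<longleftrightarrow> V \<noteq> {} \<and>
     (\<forall>P. (\<forall>x y. {x, y} \<in> N \<longrightarrow> P x \<longrightarrow> P y) \<longrightarrow> (\<forall>u\<in>V. \<forall>v\<in>V. P u \<longrightarrow> P v))"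
proof -
  let ?R = "{(x, y). {x, y} \<in> N}"
  have closed: "P v" if "(u, v) \<in> ?R\<^sup>*" "P u" "\<forall>x y. {x, y} \<in> N \<longrightarrow> P x \<longrightarrow> P y" for P u v
    using that by (induction rule: rtrancl_induct) auto
  have reach: "(u, v) \<in> ?R\<^sup>*"
    if "\<forall>P. (\<forall>x y. {x, y} \<in> N \<longrightarrow> P x \<longrightarrow> P y) \<longrightarrow> (\<forall>u\<in>V. \<forall>v\<in>V. P u \<longrightarrow> P v)"
      "u \<in> V" "v \<in> V" for u v
  proof -
    have "\<forall>x y. {x, y} \<in> N \<longrightarrow> (u, x) \<in> ?R\<^sup>* \<longrightarrow> (u, y) \<in> ?R\<^sup>*"
      by (auto intro: rtrancl_into_rtrancl)
    then show ?thesis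
      using that(1)[rule_format, of "\<lambda>x. (u, x) \<in> ?R\<^sup>*" u v] that(2,3) by blast
  qed
  show ?thesis
    unfolding connected_graph_def fst_conv snd_conv
  proof (rule conj_cong[OF refl], intro iffI allI ballI impI)
    fix P u v
    assume "\<forall>u\<in>V. \<forall>v\<in>V. (u, v) \<in> ?R\<^sup>*" "u \<in> V" "v \<in> V" "P u"
      "\<forall>x y. {x, y} \<in> N \<longrightarrow> P x \<longrightarrow> P y"
    then show "P v" using closed[of u v P] by simp
  qed (rule reach)
qed

text \<open>Every vertex other than a root \<open>r\<close> picks an edge to a vertex closer to
  \<open>r\<close>. Two vertices cannot pick the same edge, since each would have to be closer to
  \<open>r\<close> than the other.\<close>

lemma connected_graph_card_le:
  assumes "connected_graph (V, N)" "finite N"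
  shows "card V \<le> Suc (card N)"
proof -
  let ?R = "{(x, y). {x, y} \<in> N}"
  obtain r where r: "r \<in> V" using assms unfolding connected_graph_def by auto
  define dist where "dist v = (LEAST k. (v, r) \<in> ?R ^^ k)" for v
  have dist: "(v, r) \<in> ?R ^^ dist v" if "v \<in> V" for v
  proof -
    have "(v, r) \<in> ?R\<^sup>*" using assms r that unfolding connected_graph_def by simp
    then obtain k where "(v, r) \<in> ?R ^^ k" using rtrancl_imp_relpow by blast
    then show ?thesis unfolding dist_def by (rule LeastI)
  qed
  have "\<exists>w. {v, w} \<in> N \<and> dist w < dist v" if v: "v \<in> V - {r}" for v
  proof -
    have "(v, r) \<in> ?R ^^ dist v" "v \<noteq> r" using dist v by auto
    then have "dist v \<noteq> 0" by (metis relpow_0_E)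
    then obtain k where k: "dist v = Suc k" using not0_implies_Suc by blast
    then have "(v, r) \<in> ?R ^^ Suc k" using dist[of v] v by auto
    then obtain w where "(v, w) \<in> ?R" "(w, r) \<in> ?R ^^ k" by (meson relpow_Suc_D2)
    moreover from this have "dist w \<le> k" unfolding dist_def by (intro Least_le)
    ultimately show ?thesis using k by auto
  qed
  then obtain par where par: "\<And>v. v \<in> V - {r} \<Longrightarrow> {v, par v} \<in> N \<and> dist (par v) < dist v"
    by metis
  have "inj_on (\<lambda>v. {v, par v}) (V - {r})"
  proof (rule inj_onI)
    fix v w assume "v \<in> V - {r}" "w \<in> V - {r}" "{v, par v} = {w, par w}"
    then show "v = w" using par[of v] par[of w] by (auto simp: doubleton_eq_iff)
  qed
  moreover have "(\<lambda>v. {v, par v}) ` (V - {r}) \<subseteq> N" using par by auto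
  ultimately have "card (V - {r}) \<le> card N" using card_inj_on_le assms(2) by blast
  then show ?thesis using card_Diff_singleton[OF r] by linarith
qed

section \<open>Connectivity of a cycle with chords after deleting cycle edges\<close>

text \<open>Each change flips a two-valued function, so its values at the two ends differ iff the
  number of flips in between is odd.\<close>

lemma odd_card_changes_iff:
  fixes Q :: "nat \<Rightarrow> bool"
  assumes "a \<le> b"
  shows "odd (card {i \<in> {a..<b}. Q i \<noteq> Q (Suc i)}) \<longleftrightarrow> Q a \<noteq> Q b"
  using assms
proof (induction b rule: dec_induct)
  case base
  then show ?case by simp
next
  case (step b)
  have "{i \<in> {a..<Suc b}. Q i \<noteq> Q (Suc i)} =
      {i \<in> {a..<b}. Q i \<noteq> Q (Suc i)} \<union> (if Q b \<noteq> Q (Suc b) then {b} else {})"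
    using step(1) by (auto simp: less_Suc_eq)
  then have "card {i \<in> {a..<Suc b}. Q i \<noteq> Q (Suc i)} =
      card {i \<in> {a..<b}. Q i \<noteq> Q (Suc i)} + (if Q b \<noteq> Q (Suc b) then 1 else 0)"
    by (auto simp: card_insert_if)
  then show ?case using step by auto
qed

text \<open>The vertex set \<open>Q\<close> changes an even number of times around the cycle, so among at most three
  edges it changes at exactly two or none; a chord joins equal values iff the number of changes on its
  arc is even.\<close>

lemma cycle_cut_iff:
  fixes n :: nat
  assumes I: "I \<subseteq> {..<n}" "card I \<le> 3" and X: "\<And>a b. (a, b) \<in> X \<Longrightarrow> a < b \<and> b < n"
  shows "(\<forall>Q :: nat \<Rightarrow> bool.
            (\<forall>i<n. i \<notin> I \<longrightarrow> Q i = Q (Suc i mod n)) \<and> (\<forall>(a, b)\<in>X. Q a = Q b) \<longrightarrow>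
             (\<forall>i<n. Q i = Q 0)) \<longleftrightarrow>
         (\<forall>i\<in>I. \<forall>j\<in>I. i \<noteq> j \<longrightarrow> (\<exists>(a, b)\<in>X. (i \<in> {a..<b}) \<noteq> (j \<in> {a..<b})))"
    (is "?L \<longleftrightarrow> ?R")
proof
  assume L: ?L
  have sep: "\<exists>(a, b)\<in>X. (i \<in> {a..<b}) \<noteq> (j \<in> {a..<b})" if ij: "i \<in> I" "j \<in> I" "i < j" for i j
  proof (rule ccontr)
    assume C: "\<not> ?thesis"
    \<comment> \<open>If no chord separates the edges \<open>i\<close> and \<open>j\<close>, the
      vertices between them form a union of components: around the cycle \<open>Q\<close> changes
      only across these two edges, and each chord has both or none of its ends in \<open>Q\<close>.
      The bounds are half-open because edge \<open>i\<close> joins \<open>i\<close> to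
      \<open>Suc i\<close>.\<close>
    define Q where "Q v \<longleftrightarrow> i < v \<and> v \<le> j" for v
    have jn: "j < n" using ij I by auto
    have "Q l = Q (Suc l mod n)" if "l < n" "l \<notin> I" for l
    proof (cases "Suc l = n")
      case True
      moreover have "l \<noteq> j" using that ij by auto
      ultimately show ?thesis using that jn unfolding Q_def by auto
    next
      case False
      then have "Suc l mod n = Suc l" using that by simp
      moreover have "l \<noteq> i" "l \<noteq> j" using that ij by auto
      ultimately show ?thesis unfolding Q_def by auto
    qed
    moreover have "Q a = Q b" if "(a, b) \<in> X" for a b
    proof -
      have "a < b" "(i \<in> {a..<b}) = (j \<in> {a..<b})" using that C X by blast+
      then show ?thesis using ij unfolding Q_def by auto
    qed
    ultimately have C: "(\<forall>i<n. i \<notin> I \<longrightarrow> Q i = Q (Suc i mod n)) \<and> (\<forall>(a, b)\<in>X. Q a = Q b)"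
      by blast
    have const: "\<forall>l<n. Q l = Q 0" by (rule mp[OF spec[OF L, of Q] C])
    have "i < n" using jn ij by simp
    then have "Q j = Q 0" "Q i = Q 0" using const jn by blast+
    then show False using ij unfolding Q_def by auto
  qed
  show ?R
  proof (intro ballI impI)
    fix i j assume ij: "i \<in> I" "j \<in> I" "i \<noteq> j"
    show "\<exists>(a, b)\<in>X. (i \<in> {a..<b}) \<noteq> (j \<in> {a..<b})"
    proof (cases "i < j")
      case True
      then show ?thesis using sep ij by blast
    next
      case False
      then have "\<exists>(a, b)\<in>X. (j \<in> {a..<b}) \<noteq> (i \<in> {a..<b})" using sep[of j i] ij by simp
      then show ?thesis by (simp only: neq_commute)
    qed
  qed
next
  assume R: ?R
  show ?L
  proof (intro allI impI)
    fix Q :: "nat \<Rightarrow> bool" and i assume Q: "(\<forall>i<n. i \<notin> I \<longrightarrow> Q i = Q (Suc i mod n)) \<and> (\<forall>(a, b)\<in>X. Q a = Q b)"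
      and i: "i < n"
    \<comment> \<open>Reducing modulo \<open>n\<close> lets index \<open>n\<close> stand for vertex
      0 again, so that one turn around the cycle is the interval from 0 to \<open>n\<close> with
      equal values at its ends.\<close>
    define Q' where "Q' v = Q (v mod n)" for v
    define S where "S = {l \<in> {0..<n}. Q' l \<noteq> Q' (Suc l)}"
    have "S \<subseteq> I" using Q unfolding S_def Q'_def by auto
    moreover have "finite I" using I finite_subset by blast
    ultimately have "card S \<le> 3" using I card_mono by (metis le_trans)
    moreover have "even (card S)"
      using odd_card_changes_iff[of 0 n Q'] unfolding S_def by (simp add: Q'_def)
    \<comment> \<open>The bound of three deleted edges enters here. With four changes, every arc
      could contain an even number of them although they are pairwise separated.\<close>
    ultimately have "card S = 0 \<or> card S = 2" by presburger
    moreover have "card S \<noteq> 2"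
    proof
      assume "card S = 2"
      then obtain u v where S: "S = {u, v}" "u \<noteq> v" by (auto simp: card_2_iff)
      then have "u \<in> I" "v \<in> I" using \<open>S \<subseteq> I\<close> by auto
      then obtain a b where ab: "(a, b) \<in> X" "(u \<in> {a..<b}) \<noteq> (v \<in> {a..<b})"
        using R S(2) by blast
      have "{l \<in> {a..<b}. Q' l \<noteq> Q' (Suc l)} = S \<inter> {a..<b}"
        using X[OF ab(1)] unfolding S_def by auto
      moreover have "S \<inter> {a..<b} = {u} \<or> S \<inter> {a..<b} = {v}" using S ab(2) by auto
      then have "card (S \<inter> {a..<b}) = 1" by auto
      ultimately have "Q' a \<noteq> Q' b" using odd_card_changes_iff[of a b Q'] X[OF ab(1)] by simp
      then show False using Q ab(1) X[OF ab(1)] unfolding Q'_def by auto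
    qed
    ultimately have "S = {}" unfolding S_def by auto
    then have none: "{l \<in> {0..<i}. Q' l \<noteq> Q' (Suc l)} = {}" using i unfolding S_def by auto
    have "Q' 0 = Q' i" using odd_card_changes_iff[of 0 i Q'] unfolding none by simp
    then show "Q i = Q 0" using i by (simp add: Q'_def)
  qed
qed

text \<open>Vertices are addressed through \<open>h\<close> by their positions on the hamiltonian
  cycle, so that arcs become intervals of natural numbers. A cycle edge is identified with the
  position that it leaves.\<close>

definition cedge :: "(nat \<Rightarrow> 'a) \<Rightarrow> nat \<Rightarrow> nat \<Rightarrow> 'a set" where
  "cedge h n i = {h i, h (Suc i mod n)}"

text \<open>Kept as a pair of positions because, for \<open>a < b\<close>, the interval
  \<open>{a..<b}\<close> lists the cycle edges on one arc of the chord \<open>(a, b)\<close>. The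
  other arc is the complement and separates the same pairs of edges.\<close>

definition chord :: "(nat \<Rightarrow> 'a) \<Rightarrow> nat \<times> nat \<Rightarrow> 'a set" where
  "chord h q = {h (fst q), h (snd q)}"

text \<open>The cut criterion is pulled back along the injection \<open>h\<close> to properties of
  positions, where \<open>cycle_cut_iff\<close> applies. Here \<open>I\<close> holds the deleted
  cycle edges and \<open>X\<close> the remaining chords.\<close>

lemma connected_chorded_cycle_iff:
  assumes h: "inj_on h {..<n}" and n: "n > 0"
    and I: "I \<subseteq> {..<n}" "card I \<le> 3" and X: "\<And>a b. (a, b) \<in> X \<Longrightarrow> a < b \<and> b < n"
  shows "connected_graph (h ` {..<n}, cedge h n ` ({..<n} - I) \<union> chord h ` X) \<longleftrightarrow>
         (\<forall>i\<in>I. \<forall>j\<in>I. i \<noteq> j \<longrightarrow> (\<exists>(a, b)\<in>X. (i \<in> {a..<b}) \<noteq> (j \<in> {a..<b})))"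
proof -
  let ?N = "cedge h n ` ({..<n} - I) \<union> chord h ` X"
  have "connected_graph (h ` {..<n}, ?N) \<longleftrightarrow>
     (\<forall>Q :: nat \<Rightarrow> bool. (\<forall>i<n. i \<notin> I \<longrightarrow> Q i = Q (Suc i mod n)) \<and> (\<forall>(a, b)\<in>X. Q a = Q b) \<longrightarrow>
             (\<forall>i<n. Q i = Q 0))" (is "?L = (\<forall>Q. ?C Q \<longrightarrow> ?D Q)")
  proof
    assume L: ?L
    show "\<forall>Q. ?C Q \<longrightarrow> ?D Q"
    proof (intro allI impI)
      fix Q :: "nat \<Rightarrow> bool" and i assume Q: "?C Q" and i: "i < n"
      define P where "P x = Q (inv_into {..<n} h x)" for x
      have P: "P (h l) = Q l" if "l < n" for l
        unfolding P_def using that h by (simp add: inv_into_f_f)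
      have "P x = P y" if "{x, y} \<in> ?N" for x y
      proof -
        from that consider l where "l < n" "l \<notin> I" "{x, y} = {h l, h (Suc l mod n)}"
          | a b where "(a, b) \<in> X" "{x, y} = {h a, h b}"
          by (auto simp: cedge_def chord_def)
        then show ?thesis
        proof cases
          case 1
          then have "P (h l) = P (h (Suc l mod n))" using Q P n by auto
          then show ?thesis using 1(3) by (auto simp: doubleton_eq_iff)
        next
          case 2
          then have "P (h a) = P (h b)" using Q P X[OF 2(1)] by auto
          then show ?thesis using 2(2) by (auto simp: doubleton_eq_iff)
        qed
      qed
      then have closed: "\<forall>x y. {x, y} \<in> ?N \<longrightarrow> P x \<longrightarrow> P y" by blast
      have "\<forall>u\<in>h ` {..<n}. \<forall>v\<in>h ` {..<n}. P u \<longrightarrow> P v"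
        by (rule mp[OF spec[OF conjunct2[OF L[unfolded connected_graph_iff_cut]], of P] closed])
      then have "P (h i) = P (h 0)" using i n by blast
      then show "Q i = Q 0" using P i n by simp
    qed
  next
    assume R: "\<forall>Q. ?C Q \<longrightarrow> ?D Q"
    show ?L
      unfolding connected_graph_iff_cut
    proof (intro conjI allI impI)
      show "h ` {..<n} \<noteq> {}" using n by auto
    next
      fix P assume P: "\<forall>x y. {x, y} \<in> ?N \<longrightarrow> P x \<longrightarrow> P y"
      \<comment> \<open>Edges are unordered, so being preserved along them in one direction already
        means equal values at both ends.\<close>
      then have P': "P x = P y" if "{x, y} \<in> ?N" for x y
        using that by (metis insert_commute)
      have "P (h i) = P (h (Suc i mod n))" if "i < n" "i \<notin> I" for i
        by (rule P') (use that in \<open>auto simp: cedge_def\<close>)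
      moreover have "P (h a) = P (h b)" if "(a, b) \<in> X" for a b
        by (rule P') (use that in \<open>force simp: chord_def\<close>)
      ultimately have C: "?C (\<lambda>i. P (h i))" by blast
      have const: "?D (\<lambda>i. P (h i))" by (rule mp[OF spec[OF R, of "\<lambda>i. P (h i)"] C])
      show "\<forall>u\<in>h ` {..<n}. \<forall>v\<in>h ` {..<n}. P u \<longrightarrow> P v"
      proof (intro ballI impI)
        fix u v assume "u \<in> h ` {..<n}" "v \<in> h ` {..<n}" "P u"
        moreover from this obtain i j where ij: "i < n" "u = h i" "j < n" "v = h j" by blast
        moreover have "P (h i) = P (h 0)" "P (h j) = P (h 0)" using const ij by blast+
        ultimately show "P v" by simp
      qed
    qed
  qed
  also have "\<dots> \<longleftrightarrow> (\<forall>i\<in>I. \<forall>j\<in>I. i \<noteq> j \<longrightarrow> (\<exists>(a, b)\<in>X. (i \<in> {a..<b}) \<noteq> (j \<in> {a..<b})))"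
    by (rule cycle_cut_iff[OF I X])
  finally show ?thesis .
qed

section \<open>Counting pairwise separated pairs and triples\<close>

text \<open>A separated pair consists of one element of \<open>A\<close> and one outside, and it
  determines both. This counts the deletions possible when a single chord is kept.\<close>

lemma card_pairs_separated:
  assumes "finite U" "A \<subseteq> U"
  shows "card {I. I \<subseteq> U \<and> card I = 2 \<and> (\<forall>i\<in>I. \<forall>j\<in>I. i \<noteq> j \<longrightarrow> (i \<in> A) \<noteq> (j \<in> A))} =
         card A * card (U - A)"
proof -
  have "{I. I \<subseteq> U \<and> card I = 2 \<and> (\<forall>i\<in>I. \<forall>j\<in>I. i \<noteq> j \<longrightarrow> (i \<in> A) \<noteq> (j \<in> A))} =
      (\<lambda>(x, y). {x, y}) ` (A \<times> (U - A))" (is "?L = ?R")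
  proof (intro set_eqI iffI)
    fix I assume "I \<in> ?L"
    then obtain x y where xy: "I = {x, y}" "x \<noteq> y" "x \<in> U" "y \<in> U" "(x \<in> A) \<noteq> (y \<in> A)"
      by (auto simp: card_2_iff)
    show "I \<in> ?R"
    proof (cases "x \<in> A")
      case True
      then show ?thesis using xy by force
    next
      case False
      then have "(y, x) \<in> A \<times> (U - A)" "I = {y, x}" using xy by auto
      then show ?thesis by (intro image_eqI[of _ _ "(y, x)"]) auto
    qed
  next
    fix I assume "I \<in> ?R"
    then show "I \<in> ?L" using assms(2) by (auto simp: card_2_iff)
  qed
  moreover have "inj_on (\<lambda>(x, y). {x, y}) (A \<times> (U - A))"
    by (auto simp: inj_on_def doubleton_eq_iff)
  ultimately show ?thesis by (simp add: card_image card_cartesian_product)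
qed

text \<open>Intersecting a triple with each of the three disjoint sets recovers its components, so
  passing from ordered to unordered triples is injective.\<close>

lemma card_transversal_triples:
  assumes "finite A" "finite B" "finite C" "A \<inter> B = {}" "A \<inter> C = {}" "B \<inter> C = {}"
  shows "card ((\<lambda>(x, y, z). {x, y, z}) ` (A \<times> B \<times> C)) = card A * card B * card C"
proof -
  have "inj_on (\<lambda>(x, y, z). {x, y, z}) (A \<times> B \<times> C)"
  proof (rule inj_onI)
    fix p q
    assume "p \<in> A \<times> B \<times> C" "q \<in> A \<times> B \<times> C"
      and "(\<lambda>(x, y, z). {x, y, z}) p = (\<lambda>(x, y, z). {x, y, z}) q"
    then obtain x y z x' y' z' where pq: "p = (x, y, z)" "q = (x', y', z')"
      and m: "x \<in> A" "y \<in> B" "z \<in> C" "x' \<in> A" "y' \<in> B" "z' \<in> C"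
      and eq: "{x, y, z} = {x', y', z'}"
      by (cases p; cases q) simp
    have "{x, y, z} \<inter> A = {x}" "{x', y', z'} \<inter> A = {x'}"
         "{x, y, z} \<inter> B = {y}" "{x', y', z'} \<inter> B = {y'}"
         "{x, y, z} \<inter> C = {z}" "{x', y', z'} \<inter> C = {z'}"
      using m assms(4-6) by auto
    then have "{x} = {x'}" "{y} = {y'}" "{z} = {z'}" unfolding eq by (metis+)
    then show "p = q" using pq by simp
  qed
  then show ?thesis by (simp add: card_image card_cartesian_product)
qed

text \<open>The sets \<open>A\<close> and \<open>B\<close> cut \<open>U\<close> into four cells, and
  two elements are separated iff they lie in different cells. A separated triple therefore meets
  three cells once each, and the count is the elementary symmetric polynomial of degree 3 in the
  cell sizes.\<close>

lemma card_triples_separated: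
  assumes "finite U" "A \<subseteq> U" "B \<subseteq> U"
  defines "x1 \<equiv> card (A - B)" and "x2 \<equiv> card (A \<inter> B)" and "x3 \<equiv> card (B - A)"
    and "x4 \<equiv> card (U - (A \<union> B))"
  shows "card {I. I \<subseteq> U \<and> card I = 3 \<and>
            (\<forall>i\<in>I. \<forall>j\<in>I. i \<noteq> j \<longrightarrow> (i \<in> A) \<noteq> (j \<in> A) \<or> (i \<in> B) \<noteq> (j \<in> B))} =
         x1 * x2 * x3 + x1 * x2 * x4 + x1 * x3 * x4 + x2 * x3 * x4"
proof -
  define sep where "sep i j \<longleftrightarrow> (i \<in> A) \<noteq> (j \<in> A) \<or> (i \<in> B) \<noteq> (j \<in> B)" for i j
  define T where "T P Q R = (\<lambda>(x, y, z). {x, y, z}) ` (P \<times> Q \<times> R)" for P Q R :: "'a set"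
  define X1 X2 X3 X4 where X: "X1 = A - B" "X2 = A \<inter> B" "X3 = B - A" "X4 = U - (A \<union> B)"
  have fin: "finite X1" "finite X2" "finite X3" "finite X4"
    using assms(1-3) unfolding X by (auto intro: finite_subset)
  have dis: "X1 \<inter> X2 = {}" "X1 \<inter> X3 = {}" "X1 \<inter> X4 = {}" "X2 \<inter> X3 = {}" "X2 \<inter> X4 = {}"
    "X3 \<inter> X4 = {}" using X by auto
  have U: "U = X1 \<union> X2 \<union> X3 \<union> X4" using assms(2,3) X by auto
  have sub: "X1 \<subseteq> U" "X2 \<subseteq> U" "X3 \<subseteq> U" "X4 \<subseteq> U" using U by auto
  have sep_neq: "i \<noteq> j" and sep_sym: "sep j i" if "sep i j" for i j
    using that unfolding sep_def by auto
  have not_sep: "\<not> (i \<in> X1 \<and> j \<in> X1)" "\<not> (i \<in> X2 \<and> j \<in> X2)"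
      "\<not> (i \<in> X3 \<and> j \<in> X3)" "\<not> (i \<in> X4 \<and> j \<in> X4)" if "sep i j" for i j
    using that unfolding sep_def X by auto
  have sepI: "i \<in> X1 \<Longrightarrow> j \<in> X2 \<Longrightarrow> sep i j" "i \<in> X1 \<Longrightarrow> j \<in> X3 \<Longrightarrow> sep i j"
    "i \<in> X1 \<Longrightarrow> j \<in> X4 \<Longrightarrow> sep i j" "i \<in> X2 \<Longrightarrow> j \<in> X3 \<Longrightarrow> sep i j"
    "i \<in> X2 \<Longrightarrow> j \<in> X4 \<Longrightarrow> sep i j" "i \<in> X3 \<Longrightarrow> j \<in> X4 \<Longrightarrow> sep i j" for i j
    unfolding sep_def X by auto
  have TI: "{x, y, z} \<in> T P Q R" if "x \<in> P" "y \<in> Q" "z \<in> R" for x y z P Q R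
    using that unfolding T_def by force
  let ?L = "{I. I \<subseteq> U \<and> card I = 3 \<and> (\<forall>i\<in>I. \<forall>j\<in>I. i \<noteq> j \<longrightarrow> sep i j)}"
  have TD: "I \<in> ?L" if "I \<in> T P Q R" and "P \<subseteq> U" "Q \<subseteq> U" "R \<subseteq> U"
    and "\<And>x y. x \<in> P \<Longrightarrow> y \<in> Q \<Longrightarrow> sep x y" "\<And>x y. x \<in> P \<Longrightarrow> y \<in> R \<Longrightarrow> sep x y"
      "\<And>x y. x \<in> Q \<Longrightarrow> y \<in> R \<Longrightarrow> sep x y" for I P Q R
  proof -
    obtain x y z where I: "I = {x, y, z}" "x \<in> P" "y \<in> Q" "z \<in> R"
      using \<open>I \<in> T P Q R\<close> unfolding T_def by auto
    have s: "sep x y" "sep x z" "sep y z" using that I by auto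
    then have "x \<noteq> y" "x \<noteq> z" "y \<noteq> z" using sep_neq by auto
    then have "card I = 3" using I by auto
    moreover have "I \<subseteq> U" using that(2-4) I by auto
    moreover have "\<forall>i\<in>I. \<forall>j\<in>I. i \<noteq> j \<longrightarrow> sep i j" using s sep_sym unfolding I(1) by blast
    ultimately show ?thesis by simp
  qed
  have "?L = T X1 X2 X3 \<union> T X1 X2 X4 \<union> T X1 X3 X4 \<union> T X2 X3 X4" (is "_ = ?R")
  proof (intro set_eqI iffI)
    fix I assume L: "I \<in> ?L"
    then obtain x y z where I: "I = {x, y, z}" "x \<noteq> y" "x \<noteq> z" "y \<noteq> z"
      by (auto simp: card_3_iff)
    have s: "sep x y" "sep x z" "sep y z" "x \<in> U" "y \<in> U" "z \<in> U" using L I by auto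
    have perm: "I = {x, z, y}" "I = {y, x, z}" "I = {y, z, x}" "I = {z, x, y}" "I = {z, y, x}"
      using I(1) by auto
    \<comment> \<open>The names \<open>x\<close>, \<open>y\<close>, \<open>z\<close> carry no order,
      so all six assignments to the listed cells are provided.\<close>
    have m: "x \<in> P \<Longrightarrow> y \<in> Q \<Longrightarrow> z \<in> R \<Longrightarrow> I \<in> T P Q R"
      "x \<in> P \<Longrightarrow> z \<in> Q \<Longrightarrow> y \<in> R \<Longrightarrow> I \<in> T P Q R" "y \<in> P \<Longrightarrow> x \<in> Q \<Longrightarrow> z \<in> R \<Longrightarrow> I \<in> T P Q R"
      "y \<in> P \<Longrightarrow> z \<in> Q \<Longrightarrow> x \<in> R \<Longrightarrow> I \<in> T P Q R" "z \<in> P \<Longrightarrow> x \<in> Q \<Longrightarrow> y \<in> R \<Longrightarrow> I \<in> T P Q R"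
      "z \<in> P \<Longrightarrow> y \<in> Q \<Longrightarrow> x \<in> R \<Longrightarrow> I \<in> T P Q R" for P Q R
      using TI I(1) perm by metis+
    have "x \<in> X1 \<or> x \<in> X2 \<or> x \<in> X3 \<or> x \<in> X4" "y \<in> X1 \<or> y \<in> X2 \<or> y \<in> X3 \<or> y \<in> X4"
      "z \<in> X1 \<or> z \<in> X2 \<or> z \<in> X3 \<or> z \<in> X4" using s(4-6) U by auto
    then show "I \<in> ?R"
      using not_sep[OF s(1)] not_sep[OF s(2)] not_sep[OF s(3)]
      by (elim disjE) (simp_all add: m)
  next
    fix I assume "I \<in> ?R"
    then consider "I \<in> T X1 X2 X3" | "I \<in> T X1 X2 X4" | "I \<in> T X1 X3 X4" | "I \<in> T X2 X3 X4"
      by blast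
    then show "I \<in> ?L" by cases (erule TD, (fact sub sepI)+)+
  qed
  moreover have "T X1 X2 X3 \<inter> T X1 X2 X4 = {}"
    "(T X1 X2 X3 \<union> T X1 X2 X4) \<inter> T X1 X3 X4 = {}"
    "(T X1 X2 X3 \<union> T X1 X2 X4 \<union> T X1 X3 X4) \<inter> T X2 X3 X4 = {}"
  proof -
    \<comment> \<open>Two families of triples are told apart by a cell \<open>D\<close> that the
      first does not use: its triples avoid \<open>D\<close>, while every triple of the second meets
      \<open>D\<close>.\<close>
    have no: "I \<inter> D = {}" if "I \<in> T P Q R" "P \<inter> D = {}" "Q \<inter> D = {}" "R \<inter> D = {}" for I P Q R D
      using that unfolding T_def by auto
    have yes: "I \<inter> P \<noteq> {} \<and> I \<inter> Q \<noteq> {} \<and> I \<inter> R \<noteq> {}" if "I \<in> T P Q R" for I P Q R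
      using that unfolding T_def by auto
    have "I \<notin> T P Q R" if "I \<in> T P' Q' R'" "P' \<inter> D = {}" "Q' \<inter> D = {}" "R' \<inter> D = {}"
      and "D = P \<or> D = Q \<or> D = R" for I P Q R P' Q' R' D
      using no[OF that(1-4)] yes[of I P Q R] that(5) by auto
    then have "T P' Q' R' \<inter> T P Q R = {}" if "P' \<inter> D = {}" "Q' \<inter> D = {}" "R' \<inter> D = {}"
      and "D = P \<or> D = Q \<or> D = R" for P Q R P' Q' R' D
      using that by (metis disjoint_iff)
    note disjoint = this
    show "T X1 X2 X3 \<inter> T X1 X2 X4 = {}" using disjoint[of X1 X4 X2 X3] dis by simp
    show "(T X1 X2 X3 \<union> T X1 X2 X4) \<inter> T X1 X3 X4 = {}"
      using disjoint[of X1 X4 X2 X3 X1 X3 X4] disjoint[of X1 X3 X2 X4 X1 X3 X4] dis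
      by (simp add: Int_Un_distrib2 Int_Un_distrib Int_commute)
    show "(T X1 X2 X3 \<union> T X1 X2 X4 \<union> T X1 X3 X4) \<inter> T X2 X3 X4 = {}"
      using disjoint[of X1 X4 X2 X3 X2 X3 X4] disjoint[of X1 X3 X2 X4 X2 X3 X4]
        disjoint[of X1 X2 X3 X4 X2 X3 X4] dis
      by (simp add: Int_Un_distrib2 Int_Un_distrib Int_commute)
  qed
  moreover have "finite (T P Q R)" if "finite P" "finite Q" "finite R" for P Q R
    using that unfolding T_def by simp
  moreover have "card (T P Q R) = card P * card Q * card R"
    if "finite P" "finite Q" "finite R" "P \<inter> Q = {}" "P \<inter> R = {}" "Q \<inter> R = {}" for P Q R
    using card_transversal_triples[OF that] unfolding T_def .
  ultimately have "card ?L = x1 * x2 * x3 + x1 * x2 * x4 + x1 * x3 * x4 + x2 * x3 * x4"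
    using fin dis
    by (simp add: card_Un_disjoint x1_def x2_def x3_def x4_def X[symmetric])
  then show ?thesis unfolding sep_def .
qed

section \<open>Spanning trees of a cycle with two chords\<close>

text \<open>A spanning tree is given by the set \<open>X\<close> of chords that it keeps and the set
  \<open>I\<close> of cycle edges that it omits. Summing the admissible sets \<open>I\<close> over
  the four choices of \<open>X\<close> yields the formula, whether or not the chords cross.\<close>

lemma spanning_trees_chorded_cycle:
  fixes h :: "nat \<Rightarrow> 'a" and n b c d :: nat
  defines "E \<equiv> cedge h n ` {..<n} \<union> chord h ` {(0, b), (c, d)}"
  assumes h: "inj_on h {..<n}" and b: "0 < b" "b < n" and cd: "c < d" "d < n"
    and E: "card E = n + 2"
  defines "x1 \<equiv> card ({0..<b} - {c..<d})" and "x2 \<equiv> card ({0..<b} \<inter> {c..<d})"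
    and "x3 \<equiv> card ({c..<d} - {0..<b})" and "x4 \<equiv> card ({..<n} - ({0..<b} \<union> {c..<d}))"
  shows "connected_spanning (h ` {..<n}, E) (n - 1) =
     n + (x1 + x2) * (x3 + x4) + (x2 + x3) * (x1 + x4) +
     (x1 * x2 * x3 + x1 * x2 * x4 + x1 * x3 * x4 + x2 * x3 * x4)"
proof -
  let ?U = "{..<n}" and ?K = "{(0, b), (c, d)}" and ?A = "{0..<b}" and ?B = "{c..<d}"
  \<comment> \<open>The cycle contributes at most \<open>n\<close> edges and the chords at most two.
    A total of \<open>n + 2\<close> thus forces the cycle edges to be distinct, the chords to be
    distinct, and no chord to be a cycle edge.\<close>
  have "card (cedge h n ` ?U) \<le> n" using card_image_le[of ?U "cedge h n"] by simp
  moreover have K2: "card ?K \<le> 2" by (simp add: card_insert_if)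
  moreover have "card (chord h ` ?K) \<le> card ?K" by (intro card_image_le) simp
  moreover have "card E + card (cedge h n ` ?U \<inter> chord h ` ?K) =
      card (cedge h n ` ?U) + card (chord h ` ?K)"
    unfolding E_def by (intro card_Un_Int[symmetric]) auto
  ultimately have cards: "card (cedge h n ` ?U) = card ?U" "card (chord h ` ?K) = card ?K"
    "card ?K = 2" "card (cedge h n ` ?U \<inter> chord h ` ?K) = 0"
    unfolding card_lessThan using E by linarith+
  then have inj: "inj_on (cedge h n) ?U" "inj_on (chord h) ?K"
    by (simp_all only: inj_on_iff_eq_card finite_lessThan finite.intros)
  have dis: "cedge h n ` ?U \<inter> chord h ` ?K = {}" using cards(4) by simp
  have neq: "(0, b) \<noteq> (c, d)" using cards(3) by auto
  have n: "n > 0" using b by simp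
  have AB: "?A \<subseteq> ?U" "?B \<subseteq> ?U" using b cd by auto
  have Kn: "u < v \<and> v < n" if "(u, v) \<in> X" "X \<subseteq> ?K" for u v X
    using that b cd by auto
  \<comment> \<open>With the chords \<open>X\<close> kept, exactly \<open>n - 1\<close> edges remain
    iff the number of omitted cycle edges is one more than the number of kept chords.\<close>
  define J where "J X = {I. I \<subseteq> ?U \<and> card I = Suc (card X) \<and>
      (\<forall>i\<in>I. \<forall>j\<in>I. i \<noteq> j \<longrightarrow> (\<exists>(u, v)\<in>X. (i \<in> {u..<v}) \<noteq> (j \<in> {u..<v})))}"
    for X :: "(nat \<times> nat) set"
  define sub where "sub = (\<lambda>(X, I). cedge h n ` (?U - I) \<union> chord h ` X)"
  \<comment> \<open>Two chords at most mean at most three omitted cycle edges, the range in which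
    the connectivity criterion holds.\<close>
  have cK: "card X \<le> 2" and fK: "finite X" if "X \<subseteq> ?K" for X
    using that K2 card_mono[of ?K X] finite_subset[of X ?K] by auto
  have conn: "connected_graph (h ` ?U, sub (X, I)) \<longleftrightarrow>
      (\<forall>i\<in>I. \<forall>j\<in>I. i \<noteq> j \<longrightarrow> (\<exists>(u, v)\<in>X. (i \<in> {u..<v}) \<noteq> (j \<in> {u..<v})))"
    if "X \<subseteq> ?K" "I \<subseteq> ?U" "card I = Suc (card X)" for X I
    unfolding sub_def prod.case
    by (rule connected_chorded_cycle_iff[OF h n that(2)]) (use that cK Kn in auto)
  have cardsub: "card (sub (X, I)) = n - card I + card X" if "X \<subseteq> ?K" "I \<subseteq> ?U" for X I
  proof -
    have "cedge h n ` (?U - I) \<inter> chord h ` X = {}" using dis that(1) by blast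
    then have "card (sub (X, I)) = card (cedge h n ` (?U - I)) + card (chord h ` X)"
      unfolding sub_def prod.case using fK[OF that(1)] by (intro card_Un_disjoint) simp_all
    also have "card (cedge h n ` (?U - I)) = card (?U - I)"
      by (intro card_image inj_on_subset[OF inj(1)]) auto
    also have "card (chord h ` X) = card X"
      by (intro card_image inj_on_subset[OF inj(2)] that)
    finally show ?thesis using that by (simp add: card_Diff_subset finite_subset)
  qed
  have "{N. N \<subseteq> E \<and> card N = n - 1 \<and> connected_graph (h ` ?U, N)} = sub ` Sigma (Pow ?K) J"
    (is "?L = ?R")
  proof (intro set_eqI iffI)
    fix N assume N: "N \<in> ?L"
    define X I where "X = {q \<in> ?K. chord h q \<in> N}" and "I = {i \<in> ?U. cedge h n i \<notin> N}"
    have XI: "X \<subseteq> ?K" "I \<subseteq> ?U" unfolding X_def I_def by auto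
    have sub: "N = sub (X, I)"
      using N unfolding sub_def X_def I_def E_def by auto
    \<comment> \<open>This keeps the truncated subtraction in \<open>cardsub\<close> exact.\<close>
    have "card I \<le> n" using card_mono[OF _ XI(2)] by simp
    moreover have "card N = n - 1" using N by simp
    ultimately have "card I = Suc (card X)"
      using cardsub[OF XI] n unfolding sub[symmetric] by linarith
    moreover have "connected_graph (h ` ?U, sub (X, I))" using N sub by simp
    ultimately have "I \<in> J X"
      using conn[OF XI] XI(2) unfolding J_def by simp
    then show "N \<in> ?R" using sub XI by auto
  next
    fix N assume "N \<in> ?R"
    then obtain X I where XI: "X \<subseteq> ?K" "I \<in> J X" "N = sub (X, I)" by auto
    then have I: "I \<subseteq> ?U" "card I = Suc (card X)" unfolding J_def by auto
    have "N \<subseteq> E" using XI(1,3) I(1) unfolding E_def sub_def by auto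
    moreover have "card I \<le> n" using card_mono[OF _ I(1)] by simp
    then have "card N = n - 1" using cardsub[OF XI(1) I(1)] I(2) XI(3) by simp
    moreover have "connected_graph (h ` ?U, N)"
      using conn[OF XI(1) I] XI(2,3) unfolding J_def by simp
    ultimately show "N \<in> ?L" by simp
  qed
  \<comment> \<open>The inverse reads off the chords that are present and the cycle edges that are
    missing.\<close>
  moreover have "inj_on sub (Sigma (Pow ?K) J)"
  proof (rule inj_on_inverseI)
    fix z assume "z \<in> Sigma (Pow ?K) J"
    then obtain X I where z: "z = (X, I)" "X \<subseteq> ?K" "I \<subseteq> ?U" unfolding J_def by auto
    have "chord h q \<in> sub z \<longleftrightarrow> q \<in> X" if "q \<in> ?K" for q
    proof
      assume "chord h q \<in> sub z"
      then have "chord h q \<in> chord h ` X"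
        using dis that unfolding z(1) sub_def by blast
      then show "q \<in> X" using inj_on_image_mem_iff[OF inj(2) that z(2)] by blast
    qed (simp add: z(1) sub_def)
    moreover have "cedge h n i \<notin> sub z \<longleftrightarrow> i \<in> I" if "i \<in> ?U" for i
    proof
      assume "i \<in> I"
      then have "cedge h n i \<notin> cedge h n ` (?U - I)"
        using inj_on_image_mem_iff[OF inj(1) that, of "?U - I"] by blast
      then show "cedge h n i \<notin> sub z" using dis that z(2) unfolding z(1) sub_def by blast
    qed (use that in \<open>auto simp: z(1) sub_def\<close>)
    ultimately show "({q \<in> ?K. chord h q \<in> sub z}, {i \<in> ?U. cedge h n i \<notin> sub z}) = z"
      using z by blast
  qed
  ultimately have "card {N. N \<subseteq> E \<and> card N = n - 1 \<and> connected_graph (h ` ?U, N)} =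
      card (Sigma (Pow ?K) J)" by (simp add: card_image)
  also have "\<dots> = (\<Sum>X\<in>Pow ?K. card (J X))"
    by (rule card_SigmaI) (auto simp: J_def)
  also have "Pow ?K = {{}, {(0, b)}, {(c, d)}, ?K}" by (auto simp: Pow_insert)
  also have "(\<Sum>X\<in>\<dots>. card (J X)) =
      card (J {}) + card (J {(0, b)}) + card (J {(c, d)}) + card (J ?K)"
    using neq by auto
  also have "J {} = (\<lambda>i. {i}) ` ?U" unfolding J_def by (auto simp: card_1_singleton_iff)
  then have "card (J {}) = n" by (simp add: card_image)
  also have "card (J {(0, b)}) = card ?A * card (?U - ?A)"
    using card_pairs_separated[OF _ AB(1)] by (simp add: J_def numeral_2_eq_2)
  also have "card (J {(c, d)}) = card ?B * card (?U - ?B)"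
    using card_pairs_separated[OF _ AB(2)] by (simp add: J_def numeral_2_eq_2)
  also have "card (J ?K) = x1 * x2 * x3 + x1 * x2 * x4 + x1 * x3 * x4 + x2 * x3 * x4"
  proof -
    have "J ?K = {I. I \<subseteq> ?U \<and> card I = 3 \<and>
            (\<forall>i\<in>I. \<forall>j\<in>I. i \<noteq> j \<longrightarrow> (i \<in> ?A) \<noteq> (j \<in> ?A) \<or> (i \<in> ?B) \<noteq> (j \<in> ?B))}"
      unfolding J_def cards(3)
      by (simp only: bex_simps prod.case numeral_3_eq_3 numeral_2_eq_2 simp_thms)
    then show ?thesis
      using card_triples_separated[OF _ AB] unfolding x1_def x2_def x3_def x4_def by simp
  qed
  also have "card ?A = x1 + x2"
    using card_Int_Diff[of ?A ?B] unfolding x1_def x2_def by simp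
  also have "card ?B = x2 + x3"
    using card_Int_Diff[of ?B ?A] unfolding x2_def x3_def by (simp add: Int_commute)
  also have "card (?U - ?A) = x3 + x4"
  proof -
    have "(?U - ?A) \<inter> ?B = ?B - ?A" "?U - ?A - ?B = ?U - (?A \<union> ?B)" using AB by auto
    then show ?thesis using card_Int_Diff[of "?U - ?A" ?B] unfolding x3_def x4_def by simp
  qed
  also have "card (?U - ?B) = x1 + x4"
  proof -
    have "(?U - ?B) \<inter> ?A = ?A - ?B" "?U - ?B - ?A = ?U - (?A \<union> ?B)" using AB by auto
    then show ?thesis using card_Int_Diff[of "?U - ?B" ?A] unfolding x1_def x4_def by simp
  qed
  finally show ?thesis unfolding connected_spanning_def by simp
qed

section \<open>From reliability near 0 to spanning trees\<close>

text \<open>A connected graph needs at least \<open>card V - 1\<close> edges. Hence the number of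
  spanning trees is the lowest coefficient of \<open>Rel\<close> that can be nonzero.\<close>

lemma connected_spanning_eq_0:
  assumes "finite (edges G)" "Suc i < card (verts G)"
  shows "connected_spanning G i = 0"
proof -
  have "\<not> connected_graph (verts G, N)" if "N \<subseteq> edges G" "card N = i" for N
    using connected_graph_card_le[of "verts G" N] that assms finite_subset by fastforce
  then have none: "{N. N \<subseteq> edges G \<and> card N = i \<and> connected_graph (verts G, N)} = {}" by blast
  show ?thesis unfolding connected_spanning_def none by (rule card.empty)
qed

text \<open>As all coefficients below \<open>j\<close> vanish, both reliabilities carry a factor
  \<open>p ^ j\<close>. It cancels for positive \<open>p\<close>, and letting \<open>p\<close> tend
  to 0 from the right leaves the coefficients at \<open>j\<close>.\<close>

lemma connected_spanning_mono_of_Rel_le: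
  assumes Rel: "\<And>p. 0 \<le> p \<Longrightarrow> p \<le> 1 \<Longrightarrow> Rel H p \<le> Rel G p"
    and m: "card (edges H) = m" "card (edges G) = m" and j: "j \<le> m"
    and zero: "\<And>i. i < j \<Longrightarrow> connected_spanning H i = 0"
      "\<And>i. i < j \<Longrightarrow> connected_spanning G i = 0"
  shows "connected_spanning H j \<le> connected_spanning G j"
proof -
  define q where "q N p = (\<Sum>i=j..m. real (N i) * p ^ (i - j) * (1 - p) ^ (m - i))"
    for N :: "nat \<Rightarrow> nat" and p :: real
  have Rel_eq: "Rel K p = p ^ j * q (connected_spanning K) p"
    if "card (edges K) = m" "\<And>i. i < j \<Longrightarrow> connected_spanning K i = 0"
    for K :: "'c ugraph" and p
  proof -
    have "Rel K p =
        (\<Sum>i=j..m. real (connected_spanning K i) * p ^ i * (1 - p) ^ (m - i))"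
      unfolding Rel_def that(1) using that(2) by (intro sum.mono_neutral_right) auto
    also have "\<dots> = p ^ j * q (connected_spanning K) p"
      unfolding q_def sum_distrib_left
      by (intro sum.cong) (auto simp flip: power_add)
    finally show ?thesis .
  qed
  have lim: "(q N \<longlongrightarrow> real (N j)) (at_right 0)" for N
  proof -
    have "isCont (q N) 0" unfolding q_def by (intro continuous_intros)
    \<comment> \<open>At 0 the power \<open>p ^ (i - j)\<close> is 1 for \<open>i = j\<close> and 0
      for all larger \<open>i\<close>.\<close>
    moreover have "q N 0 = (\<Sum>i=j..m. if i = j then real (N i) else 0)"
      unfolding q_def by (intro sum.cong) auto
    ultimately show ?thesis
      using j by (simp add: isCont_def filterlim_at_split)
  qed
  have "q (connected_spanning H) p \<le> q (connected_spanning G) p" if "0 < p" "p < 1" for p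
    using Rel[of p] that Rel_eq[OF m(1) zero(1)] Rel_eq[OF m(2) zero(2)] by simp
  then have "eventually (\<lambda>p. q (connected_spanning H) p \<le> q (connected_spanning G) p) (at_right 0)"
    unfolding eventually_at_right_field by (intro exI[of _ 1]) auto
  from tendsto_le[OF _ lim lim this] show ?thesis by simp
qed

section \<open>Hamiltonian graphs with two extra edges as cycles with chords\<close>

lemma bij_betw_shift_mod:
  fixes n j :: nat
  assumes "n > 0"
  shows "bij_betw (\<lambda>i. (i + j) mod n) {..<n} {..<n}"
proof -
  have surj: "(\<lambda>i. (i + j) mod n) ` {..<n} = {..<n}"
  proof (intro equalityI subsetI)
    fix y assume y: "y \<in> {..<n}"
    have "j mod n < n" using assms by simp
    \<comment> \<open>The preimage of \<open>y\<close> is \<open>y - j\<close> modulo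
      \<open>n\<close>; the natural number \<open>n - j mod n\<close> plays the role of
      \<open>- j\<close>.\<close>
    have "((y + (n - j mod n)) mod n + j) mod n = (y + (n - j mod n) + j mod n) mod n"
      by (simp add: mod_simps)
    also have "y + (n - j mod n) + j mod n = y + n" using \<open>j mod n < n\<close> by simp
    finally have "y = ((y + (n - j mod n)) mod n + j) mod n" using y by simp
    then show "y \<in> (\<lambda>i. (i + j) mod n) ` {..<n}"       using assms by (intro image_eqI[of _ _ "(y + (n - j mod n)) mod n"]) auto
  qed (use assms in auto)
  then show ?thesis using finite_surj_inj[of "{..<n}"] unfolding bij_betw_def by auto
qed

text \<open>Two positions naming the same edge would have to traverse it in opposite directions,
  each being the successor of the other. That happens only on a cycle of length 2.\<close>

lemma inj_on_cedge:
  assumes h: "inj_on h {..<n}" and n: "n \<ge> 3"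
  shows "inj_on (cedge h n) {..<n}"
proof (rule inj_onI)
  fix i j assume ij: "i \<in> {..<n}" "j \<in> {..<n}" and eq: "cedge h n i = cedge h n j"
  have ne: "\<not> (i = Suc j mod n \<and> Suc i mod n = j)"
    using ij n by (auto simp: mod_Suc split: if_splits)
  have "h x = h y \<longleftrightarrow> x = y" if "x < n" "y < n" for x y
    using inj_on_eq_iff[OF h] that by simp
  then show "i = j" using eq ne ij n unfolding cedge_def doubleton_eq_iff by auto
qed

text \<open>The cycle uses \<open>n\<close> of the \<open>n + 2\<close> edges and leaves two chords.
  Rotating the numbering puts an end of the first chord at position 0, and ordering the ends of the
  second gives \<open>c < d\<close>. The chords may still be parallel or share an end.\<close>

lemma hamiltonian_graph_chorded_cycle:
  assumes G: "G \<in> hamiltonian_graphs n (n + 2)"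
  obtains h b c d where "inj_on h {..<n}" "0 < b" "b < n" "c < d" "d < n"
    "G = (h ` {..<n}, cedge h n ` {..<n} \<union> chord h ` {(0, b), (c, d)})"
proof -
  from G have simple: "simple_graph G" and cards: "card (verts G) = n" "card (edges G) = n + 2"
    unfolding hamiltonian_graphs_def by auto
  from G obtain vs where vs: "distinct vs" "set vs = verts G" "3 \<le> length vs"
      "\<forall>i<length vs. {vs ! i, vs ! (Suc i mod length vs)} \<in> edges G"
    unfolding hamiltonian_graphs_def hamiltonian_def by auto
  have len: "length vs = n" using vs(1,2) cards(1) distinct_card by metis
  have n: "n \<ge> 3" "n > 0" using vs(3) len by auto
  have fin: "finite (edges G)" using cards(2) by (intro card_ge_0_finite) simp
  define g where "g i = vs ! i" for i
  have g: "inj_on g {..<n}" "g ` {..<n} = verts G"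
    using inj_on_nth[OF vs(1), of "{..<n}"] vs(2) len unfolding g_def
    by (auto simp: set_conv_nth)
  have cyc: "cedge g n ` {..<n} \<subseteq> edges G" using vs(4) len unfolding g_def cedge_def by auto
  have "card (edges G - cedge g n ` {..<n}) = 2"
    using card_Diff_subset[OF _ cyc] card_image[OF inj_on_cedge[OF g(1) n(1)]] cards(2) by simp
  then obtain e f where "edges G - cedge g n ` {..<n} = {e, f}" by (auto simp: card_2_iff)
  then have edges: "edges G = cedge g n ` {..<n} \<union> {e, f}" using cyc by blast
  have ends: "\<exists>u\<in>verts G. \<exists>v\<in>verts G. u \<noteq> v \<and> e' = {u, v}" if "e' \<in> edges G" for e'
  proof -
    have "e' \<subseteq> verts G" "card e' = 2" using simple that unfolding simple_graph_def by blast+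
    moreover from this obtain u v where "e' = {u, v}" "u \<noteq> v" unfolding card_2_iff by blast
    ultimately show ?thesis by blast
  qed
  have ef: "e \<in> edges G" "f \<in> edges G" using edges by simp_all
  obtain u v where e: "u \<in> verts G" "v \<in> verts G" "u \<noteq> v" "e = {u, v}"
    using ends[OF ef(1)] by blast
  obtain w z where f: "w \<in> verts G" "z \<in> verts G" "w \<noteq> z" "f = {w, z}"
    using ends[OF ef(2)] by blast
  obtain j where j: "j < n" "u = g j" using e(1) g(2) by auto
  define h where "h i = g ((i + j) mod n)" for i
  note shift = bij_betw_shift_mod[OF n(2), of j]
  have h: "inj_on h {..<n}" "h ` {..<n} = verts G"
  proof -
    have "h = g \<circ> (\<lambda>i. (i + j) mod n)" unfolding h_def by auto
    moreover have "bij_betw g {..<n} (verts G)" using g by (simp add: bij_betw_def)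
    ultimately have "bij_betw h {..<n} (verts G)" using bij_betw_trans[OF shift] by metis
    then show "inj_on h {..<n}" "h ` {..<n} = verts G" by (simp_all add: bij_betw_def)
  qed
  have "cedge h n i = cedge g n ((i + j) mod n)" for i
    unfolding cedge_def h_def by (simp add: mod_simps)
  then have "cedge h n ` {..<n} = cedge g n ` (\<lambda>i. (i + j) mod n) ` {..<n}"
    by (simp add: image_image)
  then have cycle: "cedge h n ` {..<n} = cedge g n ` {..<n}"
    using shift unfolding bij_betw_def by simp
  have h0: "h 0 = u" using j unfolding h_def by simp
  obtain b where b: "b < n" "v = h b" using e(2) h(2) by auto
  obtain c' d' where cd': "c' < n" "w = h c'" "d' < n" "z = h d'"
    using f(1,2) unfolding h(2)[symmetric] by blast
  define c d where "c = min c' d'" and "d = max c' d'"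
  have "c' \<noteq> d'" using cd' f(3) by auto
  then have cd: "c < d" "d < n" "f = {h c, h d}"
    using cd' f(4) unfolding c_def d_def by (auto simp: min_def max_def not_le)
  have "b \<noteq> 0" using e(3) h0 b(2) by metis
  have "edges G = cedge h n ` {..<n} \<union> chord h ` {(0, b), (c, d)}"
    unfolding edges cycle e(4) cd(3) chord_def using h0 b by simp
  then have "G = (h ` {..<n}, cedge h n ` {..<n} \<union> chord h ` {(0, b), (c, d)})"
    using h(2) by (metis prod.collapse)
  with h(1) \<open>b \<noteq> 0\<close> b(1) cd(1,2) show ?thesis by (intro that) auto
qed

text \<open>Each arc of a crossing chord has an end of the other chord in its interior, so neither
  chord is a cycle edge, and the four ends are distinct. This supplies the graph with which a most
  reliable one is compared.\<close>

lemma chorded_cycle_hamiltonian_graph: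
  assumes h: "inj_on h {..<n}" and cross: "0 < c" "c < b" "b < d" "d < n"
  shows "(h ` {..<n}, cedge h n ` {..<n} \<union> chord h ` {(0, b), (c, d)}) \<in> hamiltonian_graphs n (n + 2)"
    (is "?H \<in> _")
proof -
  have n: "n \<ge> 3" using cross by simp
  have eq: "h x = h y \<longleftrightarrow> x = y" if "x < n" "y < n" for x y
    using inj_on_eq_iff[OF h] that by simp
  have Suc_mod: "Suc i mod n = (if Suc i = n then 0 else Suc i)" if "i < n" for i
    using that by auto
  have notin: "chord h (0, b) \<notin> cedge h n ` {..<n}" "chord h (c, d) \<notin> cedge h n ` {..<n}"
    using cross n by (auto simp: chord_def cedge_def doubleton_eq_iff eq Suc_mod split: if_splits)
  have neq: "chord h (0, b) \<noteq> chord h (c, d)"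
    using cross n by (auto simp: chord_def doubleton_eq_iff eq)
  have "card (cedge h n ` {..<n}) = n" using card_image[OF inj_on_cedge[OF h n]] by simp
  then have "card (edges ?H) = n + 2" using notin neq by simp
  moreover have "card (verts ?H) = n" using card_image[OF h] by simp
  moreover have "simple_graph ?H"
    unfolding simple_graph_def using cross n
    by (auto simp: chord_def cedge_def eq Suc_mod card_insert_if split: if_splits)
  moreover have "hamiltonian ?H"
    unfolding hamiltonian_def
  proof (intro exI[of _ "map h [0..<n]"] conjI allI impI)
    show "distinct (map h [0..<n])" using h by (simp add: distinct_map atLeast0LessThan)
    show "set (map h [0..<n]) = verts ?H" by (simp add: atLeast0LessThan)
    show "3 \<le> length (map h [0..<n])" using n by simp
  next
    fix i assume i: "i < length (map h [0..<n])"
    then have "cedge h n i \<in> edges ?H" by simp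
    moreover have "map h [0..<n] ! i = h i"
      "map h [0..<n] ! (Suc i mod length (map h [0..<n])) = h (Suc i mod n)"
      using i n by simp_all
    ultimately show "{map h [0..<n] ! i, map h [0..<n] ! (Suc i mod length (map h [0..<n]))} \<in> edges ?H"
      by (simp only: cedge_def)
  qed
  ultimately show ?thesis by (simp only: hamiltonian_graphs_def mem_Collect_eq simp_thms)
qed

section \<open>Isomorphisms with graphs of type A\<close>

lemma graph_iso_trans:
  assumes "graph_iso G H" "graph_iso H K"
  shows "graph_iso G K"
proof -
  obtain f where f: "bij_betw f (verts G) (verts H)" "(\<lambda>e. f ` e) ` edges G = edges H"
    using assms(1) unfolding graph_iso_def by metis
  obtain g where g: "bij_betw g (verts H) (verts K)" "(\<lambda>e. g ` e) ` edges H = edges K"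
    using assms(2) unfolding graph_iso_def by metis
  have "(\<lambda>e. (g \<circ> f) ` e) ` edges G = edges K"
    unfolding g(2)[symmetric] f(2)[symmetric] by (simp add: image_image image_comp)
  with bij_betw_trans[OF f(1) g(1)] show ?thesis
    unfolding graph_iso_def by (intro exI[of _ "g \<circ> f"] conjI)
qed

text \<open>Moving the starting point to the second chord end, at position \<open>x1\<close>,
  exchanges the roles of the two chords. The shift adds \<open>n - x1\<close>, which is
  \<open>- x1\<close> modulo \<open>n\<close>.\<close>

lemma graph_iso_type_A_rotate:
  assumes "x1 + x2 + x3 + x4 > 0"
  shows "graph_iso (type_A (x1, x2, x3, x4)) (type_A (x2, x3, x4, x1))"
proof -
  define n where "n = x1 + x2 + x3 + x4"
  define f where "f i = (i + (n - x1)) mod n" for i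
  have n: "n > 0" "x1 \<le> n" using assms unfolding n_def by auto
  have bij: "bij_betw f {..<n} {..<n}"
    unfolding f_def by (rule bij_betw_shift_mod[OF n(1)])
  have f_mod: "f (i mod n) = f i" and f_Suc: "f (Suc i mod n) = Suc (f i) mod n" for i
    unfolding f_def by (simp_all add: mod_simps)
  have f: "f (x1 + i) = i mod n" for i
  proof -
    have "x1 + i + (n - x1) = i + n" using n(2) by simp
    then show ?thesis unfolding f_def by simp
  qed
  have f0: "f 0 = (x2 + x3 + x4) mod n" unfolding f_def n_def by (simp add: add.assoc)
  have "{{i, Suc i mod n} |i. i < n} = (\<lambda>i. {i, Suc i mod n}) ` {..<n}" by auto
  moreover have "(\<lambda>e. f ` e) ` (\<lambda>i. {i, Suc i mod n}) ` {..<n} =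
      (\<lambda>i. {i, Suc i mod n}) ` f ` {..<n}"
    by (simp add: image_image f_Suc)
  moreover have "f ` {..<n} = {..<n}" using bij unfolding bij_betw_def by simp
  moreover have "f ` {0, (x1 + x2) mod n} = {x2 mod n, (x2 + x3 + x4) mod n}"
    "f ` {x1 mod n, (x1 + x2 + x3) mod n} = {0, (x2 + x3) mod n}"
    using f[of 0] f[of x2] f[of "x2 + x3"] n(1) by (auto simp: f_mod f0 add.assoc)
  ultimately have "(\<lambda>e. f ` e) ` edges (type_A (x1, x2, x3, x4)) = edges (type_A (x2, x3, x4, x1))"
    unfolding type_A_def Let_def prod.case snd_conv n_def[symmetric]
    by (simp add: image_Un n_def[symmetric] add.commute[of _ x1] add.assoc[symmetric] insert_commute)
  moreover have "verts (type_A (x1, x2, x3, x4)) = {..<n}" "verts (type_A (x2, x3, x4, x1)) = {..<n}"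
    unfolding type_A_def Let_def n_def by (simp_all add: ac_simps)
  ultimately show ?thesis using bij unfolding graph_iso_def by auto
qed

text \<open>The chord ends appear in the order 0, \<open>c\<close>, \<open>b\<close>,
  \<open>d\<close>, and the gaps between them are the c-path lengths. The isomorphism is the inverse
  of the numbering \<open>h\<close>.\<close>

lemma graph_iso_chorded_cycle_type_A:
  assumes h: "inj_on h {..<n}" and cross: "0 < c" "c < b" "b < d" "d < n"
  shows "graph_iso (h ` {..<n}, cedge h n ` {..<n} \<union> chord h ` {(0, b), (c, d)})
           (type_A (c, b - c, d - b, n - d))"
proof -
  let ?E = "(\<lambda>i. {i, Suc i mod n}) ` {..<n} \<union> {{0, b}, {c, d}}"
  let ?f = "inv_into {..<n} h"
  have A: "type_A (c, b - c, d - b, n - d) = ({..<n}, ?E)"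
    unfolding type_A_def using cross by auto
  have E: "cedge h n ` {..<n} \<union> chord h ` {(0, b), (c, d)} = (\<lambda>e. h ` e) ` ?E"
    by (simp add: image_Un image_image cedge_def chord_def)
  have "?f ` h ` e = e" if "e \<in> ?E" for e
    using that cross by (intro inv_into_image_cancel[OF h]) auto
  then have "(\<lambda>e. ?f ` e) ` (\<lambda>e. h ` e) ` ?E = ?E"
    by (simp only: image_image) (rule trans[OF image_cong[OF refl] image_ident], simp)
  moreover have "bij_betw ?f (h ` {..<n}) {..<n}"
    using h by (intro bij_betw_inv_into) (simp add: bij_betw_def)
  ultimately show ?thesis unfolding A E graph_iso_def by auto
qed

section \<open>Maximizing the number of spanning trees\<close>

text \<open>The linear part counts the spanning trees without chords, the two products those with
  exactly one chord, and the cubic part those with both.\<close>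

definition tree_count :: "nat \<Rightarrow> nat \<Rightarrow> nat \<Rightarrow> nat \<Rightarrow> nat" where
  "tree_count x1 x2 x3 x4 =
     (x1 + x2 + x3 + x4) + (x1 + x2) * (x3 + x4) + (x2 + x3) * (x1 + x4) +
     (x1 * x2 * x3 + x1 * x2 * x4 + x1 * x3 * x4 + x2 * x3 * x4)"

text \<open>Obtained from \<open>tree_count\<close> by completing squares in the opposite pairs \<open>x1, x3\<close> and \<open>x2, x4\<close>.\<close>

definition tree_defect :: "int \<Rightarrow> int \<Rightarrow> int \<Rightarrow> int \<Rightarrow> int" where
  "tree_defect x1 x2 x3 x4 =
     ((x1 + x3) - (x2 + x4))\<^sup>2 * (x1 + x2 + x3 + x4) +
     4 * (x1 - x3)\<^sup>2 * (x2 + x4 + 2) + 4 * (x2 - x4)\<^sup>2 * (x1 + x3 + 2)"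

text \<open>For a fixed sum, maximizing \<open>tree_count\<close> amounts to minimizing
  \<open>tree_defect\<close>, a sum of squares with nonnegative weights. The factor 16 clears the
  denominators from completing the squares.\<close>

lemma tree_count_defect:
  fixes x1 x2 x3 x4 :: nat
  defines "n \<equiv> int (x1 + x2 + x3 + x4)"
  shows "16 * int (tree_count x1 x2 x3 x4) =
    n ^ 3 + 8 * n\<^sup>2 + 16 * n - tree_defect (int x1) (int x2) (int x3) (int x4)"
  unfolding n_def tree_count_def tree_defect_def
  by (simp add: algebra_simps power2_eq_square power3_eq_cube)

lemma square_le_1_cases:
  fixes z :: int
  assumes "z\<^sup>2 \<le> 1"
  shows "z = -1 \<or> z = 0 \<or> z = 1"
proof -
  have "\<bar>z\<bar> \<le> 1" using assms by (simp add: abs_square_le_1)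
  then show ?thesis by linarith
qed

lemma square_ge_cases:
  fixes z m :: int
  assumes "0 \<le> m"
  shows "\<bar>z\<bar> < m \<or> m\<^sup>2 \<le> z\<^sup>2"
proof (cases "\<bar>z\<bar> < m")
  case False
  then have "m\<^sup>2 \<le> \<bar>z\<bar>\<^sup>2" using assms by (intro power_mono) auto
  then show ?thesis by simp
qed simp

lemma square_mult_eq_0_of_nonpos:
  fixes z c :: int
  assumes "z\<^sup>2 * c \<le> 0" "c > 0"
  shows "z = 0"
proof -
  have "z\<^sup>2 \<le> 0" using assms by (simp add: mult_le_0_iff)
  then show ?thesis by simp
qed

text \<open>An odd square is at least 1, so the first term alone uses up the bound \<open>c\<close>
  and leaves nothing for \<open>r\<close>. It is applied to the difference within an opposite pair
  whose sum is odd.\<close>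

lemma square_mult_odd:
  fixes z c :: int
  assumes "z\<^sup>2 * c + r \<le> c" "c > 0" "odd z" "0 \<le> r"
  shows "(z = 1 \<or> z = -1) \<and> r = 0"
proof -
  have "z\<^sup>2 * c \<le> 1 * c" using assms by linarith
  then have "z\<^sup>2 \<le> 1" using assms(2) mult_le_cancel_right_pos by blast
  then have "z = 1 \<or> z = -1" using square_le_1_cases assms(3) by fastforce
  then show ?thesis using assms(1,4) by auto
qed

text \<open>The sums \<open>s\<close> and \<open>t\<close> of the opposite pairs and the differences
  \<open>d\<close>, \<open>u\<close>, \<open>v\<close> are coordinates in which every term of the
  defect is a weighted square. The bound limits \<open>d\<close>, the parity of the total restricts
  it further, and the rest of the bound settles \<open>u\<close> and \<open>v\<close>.\<close>

lemma tree_defect_minimal: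
  fixes x1 x2 x3 x4 k :: int
  assumes nonneg: "0 \<le> x1" "0 \<le> x2" "0 \<le> x3" "0 \<le> x4" and k: "k \<ge> 1"
  shows "x1 + x2 + x3 + x4 = 4 * k \<Longrightarrow> tree_defect x1 x2 x3 x4 \<le> tree_defect k k k k \<Longrightarrow>
           (x1, x2, x3, x4) = (k, k, k, k)" (is "?S0 \<Longrightarrow> ?D0 \<Longrightarrow> _")
    and "x1 + x2 + x3 + x4 = 4 * k + 1 \<Longrightarrow>
           tree_defect x1 x2 x3 x4 \<le> tree_defect (k + 1) k k k \<Longrightarrow>
           (x1, x2, x3, x4) \<in> {(k + 1, k, k, k), (k, k + 1, k, k), (k, k, k + 1, k), (k, k, k, k + 1)}"
      (is "?S1 \<Longrightarrow> ?D1 \<Longrightarrow> _")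
    and "x1 + x2 + x3 + x4 = 4 * k + 2 \<Longrightarrow>
           tree_defect x1 x2 x3 x4 \<le> tree_defect (k + 1) k (k + 1) k \<Longrightarrow>
           (x1, x2, x3, x4) \<in> {(k + 1, k, k + 1, k), (k, k + 1, k, k + 1)}"
      (is "?S2 \<Longrightarrow> ?D2 \<Longrightarrow> _")
    and "x1 + x2 + x3 + x4 = 4 * k + 3 \<Longrightarrow>
           tree_defect x1 x2 x3 x4 \<le> tree_defect (k + 1) (k + 1) (k + 1) k \<Longrightarrow>
           (x1, x2, x3, x4) \<in> {(k, k + 1, k + 1, k + 1), (k + 1, k, k + 1, k + 1),
             (k + 1, k + 1, k, k + 1), (k + 1, k + 1, k + 1, k)}"
      (is "?S3 \<Longrightarrow> ?D3 \<Longrightarrow> _")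
proof -
  define s t d u v where defs: "s = x1 + x3" "t = x2 + x4" "d = s - t" "u = x1 - x3" "v = x2 - x4"
  define n where "n = s + t"
  have D: "tree_defect x1 x2 x3 x4 = d\<^sup>2 * n + 4 * (u\<^sup>2 * (t + 2)) + 4 * (v\<^sup>2 * (s + 2))"
    unfolding tree_defect_def n_def defs by (simp add: algebra_simps)
  have st: "0 \<le> s" "0 \<le> t" using nonneg unfolding defs by auto
  have u0: "0 \<le> u\<^sup>2 * (t + 2)" and v0: "0 \<le> v\<^sup>2 * (s + 2)" using st by simp_all
  have d0: "0 \<le> d\<^sup>2 * n" using st unfolding n_def by simp
  have "\<bar>d\<bar> < m \<or> m\<^sup>2 * n \<le> d\<^sup>2 * n" if "0 \<le> m" for m
    using square_ge_cases[OF that, of d] mult_right_mono[of "m\<^sup>2" "d\<^sup>2" n] st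
    unfolding n_def by linarith
  \<comment> \<open>The value 3 serves the odd totals, where \<open>9 * n\<close> exceeds the
    permitted defect; the value 4 serves \<open>4 * k + 2\<close>, where the permitted defect is
    \<open>4 * n\<close>.\<close>
  from this[of 3] this[of 4]
  have d9: "\<bar>d\<bar> \<le> 2 \<or> 9 * n \<le> d\<^sup>2 * n" and d16: "\<bar>d\<bar> \<le> 3 \<or> 16 * n \<le> d\<^sup>2 * n"
    by simp_all linarith+
  have x: "2 * x1 = s + u" "2 * x3 = s - u" "2 * x2 = t + v" "2 * x4 = t - v"
    unfolding defs by auto
  have sum: "x1 + x2 + x3 + x4 = n" unfolding n_def defs by simp
  show "(x1, x2, x3, x4) = (k, k, k, k)" if ?S0 ?D0
  proof -
    have n: "n = 4 * k" using that sum by simp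
    have "d\<^sup>2 * n + 4 * (u\<^sup>2 * (t + 2)) + 4 * (v\<^sup>2 * (s + 2)) \<le> 0"
      using that(2) unfolding D by (simp add: tree_defect_def)
    then have "d\<^sup>2 * n \<le> 0" "u\<^sup>2 * (t + 2) \<le> 0" "v\<^sup>2 * (s + 2) \<le> 0" using d0 u0 v0 by linarith+
    then have "d = 0" "u = 0" "v = 0" using square_mult_eq_0_of_nonpos st k n by fastforce+
    then show ?thesis using x n unfolding n_def defs(3) by auto
  qed
  show "(x1, x2, x3, x4) \<in> {(k + 1, k, k, k), (k, k + 1, k, k), (k, k, k + 1, k), (k, k, k, k + 1)}"
    if ?S1 ?D1
  proof -
    have n: "n = 4 * k + 1" using that sum by simp
    \<comment> \<open>The bound is \<open>n + 4 * (2 * k + 2)\<close>: the reference vector has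
      \<open>d = 1\<close>, \<open>u = 1\<close> and \<open>v = 0\<close>.\<close>
    have le: "d\<^sup>2 * n + 4 * (u\<^sup>2 * (t + 2)) + 4 * (v\<^sup>2 * (s + 2)) \<le> 12 * k + 9"
      using that(2) unfolding D by (simp add: tree_defect_def)
    then have "\<bar>d\<bar> \<le> 2" using d9 u0 v0 k n by linarith
    moreover have "odd d" using n unfolding n_def defs(3) by presburger
    ultimately have "d = 1 \<or> d = -1" by presburger
    then show ?thesis
    proof
      assume d: "d = 1"
      then have s: "s = 2 * k + 1" "t = 2 * k" using n unfolding n_def defs(3) by auto
      have "odd u" using x(1) s by presburger
      \<comment> \<open>Once \<open>d\<^sup>2 * n\<close> is paid, exactly the cost of a difference
        of 1 in the odd pair is left.\<close>
      moreover have "u\<^sup>2 * (t + 2) + v\<^sup>2 * (s + 2) \<le> t + 2" using le d n s by simp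
      ultimately have "(u = 1 \<or> u = -1) \<and> v\<^sup>2 * (s + 2) = 0"
        using square_mult_odd[of u "t + 2" "v\<^sup>2 * (s + 2)"] v0 st by simp
      then show ?thesis using x s st by auto
    next
      assume d: "d = -1"
      then have s: "s = 2 * k" "t = 2 * k + 1" using n unfolding n_def defs(3) by auto
      have "odd v" using x(3) s by presburger
      moreover have "v\<^sup>2 * (s + 2) + u\<^sup>2 * (t + 2) \<le> s + 2" using le d n s by simp
      ultimately have "(v = 1 \<or> v = -1) \<and> u\<^sup>2 * (t + 2) = 0"
        using square_mult_odd[of v "s + 2" "u\<^sup>2 * (t + 2)"] u0 st by simp
      then show ?thesis using x s st by auto
    qed
  qed
  show "(x1, x2, x3, x4) \<in> {(k + 1, k, k + 1, k), (k, k + 1, k, k + 1)}" if ?S2 ?D2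
  proof -
    have n: "n = 4 * k + 2" using that sum by simp
    have le: "d\<^sup>2 * n + 4 * (u\<^sup>2 * (t + 2)) + 4 * (v\<^sup>2 * (s + 2)) \<le> 4 * n"
      using that(2) n unfolding D by (simp add: tree_defect_def)
    then have "\<bar>d\<bar> \<le> 3" using d16 u0 v0 k n by linarith
    moreover have "even d" using n unfolding n_def defs(3) by presburger
    ultimately have "d = 2 \<or> d = -2 \<or> d = 0" by presburger
    \<comment> \<open>Equal sums would both be odd, forcing a nonzero difference in each pair. That
      costs at least \<open>4 * (n + 4)\<close>, more than the imbalance \<open>d = 2\<close> with
      both differences zero.\<close>
    moreover have "d \<noteq> 0"
    proof
      assume "d = 0"
      then have s: "s = 2 * k + 1" "t = 2 * k + 1" using n unfolding n_def defs(3) by auto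
      have "u \<noteq> 0" "v \<noteq> 0" using x s by presburger+
      then have "1 \<le> u\<^sup>2" "1 \<le> v\<^sup>2" by (simp_all add: int_one_le_iff_zero_less)
      then have "1 * (t + 2) \<le> u\<^sup>2 * (t + 2)" "1 * (s + 2) \<le> v\<^sup>2 * (s + 2)"
        using st by (intro mult_right_mono; simp)+
      then show False using le \<open>d = 0\<close> n s by simp
    qed
    ultimately have d: "d = 2 \<or> d = -2" by simp
    then have "d\<^sup>2 * n = 4 * n" by auto
    then have "u\<^sup>2 * (t + 2) \<le> 0" "v\<^sup>2 * (s + 2) \<le> 0" using le u0 v0 by linarith+
    then have "u = 0" "v = 0" using square_mult_eq_0_of_nonpos st by fastforce+
    then show ?thesis using d x n unfolding n_def defs(3) by auto
  qed
  show "(x1, x2, x3, x4) \<in> {(k, k + 1, k + 1, k + 1), (k + 1, k, k + 1, k + 1),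
             (k + 1, k + 1, k, k + 1), (k + 1, k + 1, k + 1, k)}" if ?S3 ?D3
  proof -
    have n: "n = 4 * k + 3" using that sum by simp
    \<comment> \<open>The bound is \<open>n + 4 * (2 * k + 4)\<close>: the reference vector has
      \<open>d = 1\<close>, \<open>u = 0\<close> and \<open>v = 1\<close>, and its even pair has sum
      \<open>2 * k + 2\<close>.\<close>
    have le: "d\<^sup>2 * n + 4 * (u\<^sup>2 * (t + 2)) + 4 * (v\<^sup>2 * (s + 2)) \<le> 12 * k + 19"
      using that(2) unfolding D by (simp add: tree_defect_def)
    then have "\<bar>d\<bar> \<le> 2" using d9 u0 v0 k n by linarith
    moreover have "odd d" using n unfolding n_def defs(3) by presburger
    ultimately have "d = 1 \<or> d = -1" by presburger
    then show ?thesis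
    proof
      assume d: "d = -1"
      then have s: "s = 2 * k + 1" "t = 2 * k + 2" using n unfolding n_def defs(3) by auto
      have "odd u" using x(1) s by presburger
      moreover have "u\<^sup>2 * (t + 2) + v\<^sup>2 * (s + 2) \<le> t + 2" using le d n s by simp
      ultimately have "(u = 1 \<or> u = -1) \<and> v\<^sup>2 * (s + 2) = 0"
        using square_mult_odd[of u "t + 2" "v\<^sup>2 * (s + 2)"] v0 st by simp
      then show ?thesis using x s st by auto
    next
      assume d: "d = 1"
      then have s: "s = 2 * k + 2" "t = 2 * k + 1" using n unfolding n_def defs(3) by auto
      have "odd v" using x(3) s by presburger
      moreover have "v\<^sup>2 * (s + 2) + u\<^sup>2 * (t + 2) \<le> s + 2" using le d n s by simp
      ultimately have "(v = 1 \<or> v = -1) \<and> u\<^sup>2 * (t + 2) = 0"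
        using square_mult_odd[of v "s + 2" "u\<^sup>2 * (t + 2)"] u0 st by simp
      then show ?thesis using x s st by auto
    qed
  qed
qed

text \<open>For equal sums, \<open>tree_count_defect\<close> reverses the comparison, so the
  minimizers over the integers are the maximizers here. The detour through integers is due to the
  differences in the defect.\<close>

lemma tree_count_maximal:
  fixes x1 x2 x3 x4 k :: nat
  assumes k: "k \<ge> 1"
  shows "x1 + x2 + x3 + x4 = 4 * k \<Longrightarrow> tree_count k k k k \<le> tree_count x1 x2 x3 x4 \<Longrightarrow>
           (x1, x2, x3, x4) = (k, k, k, k)"
    and "x1 + x2 + x3 + x4 = 4 * k + 1 \<Longrightarrow>
           tree_count (k + 1) k k k \<le> tree_count x1 x2 x3 x4 \<Longrightarrow>
           (x1, x2, x3, x4) \<in> {(k + 1, k, k, k), (k, k + 1, k, k), (k, k, k + 1, k), (k, k, k, k + 1)}"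
    and "x1 + x2 + x3 + x4 = 4 * k + 2 \<Longrightarrow>
           tree_count (k + 1) k (k + 1) k \<le> tree_count x1 x2 x3 x4 \<Longrightarrow>
           (x1, x2, x3, x4) \<in> {(k + 1, k, k + 1, k), (k, k + 1, k, k + 1)}"
    and "x1 + x2 + x3 + x4 = 4 * k + 3 \<Longrightarrow>
           tree_count (k + 1) (k + 1) (k + 1) k \<le> tree_count x1 x2 x3 x4 \<Longrightarrow>
           (x1, x2, x3, x4) \<in> {(k, k + 1, k + 1, k + 1), (k + 1, k, k + 1, k + 1),
             (k + 1, k + 1, k, k + 1), (k + 1, k + 1, k + 1, k)}"
proof -
  have le: "tree_defect (int x1) (int x2) (int x3) (int x4) \<le>
      tree_defect (int y1) (int y2) (int y3) (int y4)"
    if "tree_count y1 y2 y3 y4 \<le> tree_count x1 x2 x3 x4"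
      "y1 + y2 + y3 + y4 = x1 + x2 + x3 + x4" for y1 y2 y3 y4
    using that(1) tree_count_defect[of y1 y2 y3 y4] tree_count_defect[of x1 x2 x3 x4]
    unfolding that(2) by linarith
  have k': "1 \<le> int k" and Suc_k: "int k + 1 = int (k + 1)" using k by simp_all
  note min = tree_defect_minimal[OF of_nat_0_le_iff of_nat_0_le_iff of_nat_0_le_iff of_nat_0_le_iff k',
      of x1 x2 x3 x4]
  show "(x1, x2, x3, x4) = (k, k, k, k)"
    if "x1 + x2 + x3 + x4 = 4 * k" "tree_count k k k k \<le> tree_count x1 x2 x3 x4"
  proof -
    have "int x1 + int x2 + int x3 + int x4 = 4 * int k" using that(1) by linarith
    from min(1)[OF this] le[OF that(2)] that(1) show ?thesis by simp
  qed
  show "(x1, x2, x3, x4) \<in> {(k + 1, k, k, k), (k, k + 1, k, k), (k, k, k + 1, k), (k, k, k, k + 1)}"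
    if "x1 + x2 + x3 + x4 = 4 * k + 1" "tree_count (k + 1) k k k \<le> tree_count x1 x2 x3 x4"
  proof -
    have sum: "int x1 + int x2 + int x3 + int x4 = 4 * int k + 1" using that(1) by linarith
    have "tree_defect (int x1) (int x2) (int x3) (int x4) \<le>
        tree_defect (int k + 1) (int k) (int k) (int k)"
      using le[OF that(2)] that(1) by (simp only: of_nat_add of_nat_1)
    from min(2)[OF sum this, unfolded Suc_k] show ?thesis
      by (simp only: insert_iff empty_iff prod.inject of_nat_eq_iff)
  qed
  show "(x1, x2, x3, x4) \<in> {(k + 1, k, k + 1, k), (k, k + 1, k, k + 1)}"
    if "x1 + x2 + x3 + x4 = 4 * k + 2" "tree_count (k + 1) k (k + 1) k \<le> tree_count x1 x2 x3 x4"
  proof -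
    have sum: "int x1 + int x2 + int x3 + int x4 = 4 * int k + 2" using that(1) by linarith
    have "tree_defect (int x1) (int x2) (int x3) (int x4) \<le>
        tree_defect (int k + 1) (int k) (int k + 1) (int k)"
      using le[OF that(2)] that(1) by (simp only: of_nat_add of_nat_1)
    from min(3)[OF sum this, unfolded Suc_k] show ?thesis
      by (simp only: insert_iff empty_iff prod.inject of_nat_eq_iff)
  qed
  show "(x1, x2, x3, x4) \<in> {(k, k + 1, k + 1, k + 1), (k + 1, k, k + 1, k + 1),
             (k + 1, k + 1, k, k + 1), (k + 1, k + 1, k + 1, k)}"
    if "x1 + x2 + x3 + x4 = 4 * k + 3"
      "tree_count (k + 1) (k + 1) (k + 1) k \<le> tree_count x1 x2 x3 x4"
  proof -
    have sum: "int x1 + int x2 + int x3 + int x4 = 4 * int k + 3" using that(1) by linarith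
    have "tree_defect (int x1) (int x2) (int x3) (int x4) \<le>
        tree_defect (int k + 1) (int k + 1) (int k + 1) (int k)"
      using le[OF that(2)] that(1) by (simp only: of_nat_add of_nat_1)
    from min(4)[OF sum this, unfolded Suc_k] show ?thesis
      by (simp only: insert_iff empty_iff prod.inject of_nat_eq_iff)
  qed
qed

section \<open>Identifying the most reliable graph\<close>

lemma spanning_trees_crossing_chords:
  assumes h: "inj_on h {..<n}" and cross: "0 < c" "c < b" "b < d" "d < n"
  shows "connected_spanning (h ` {..<n}, cedge h n ` {..<n} \<union> chord h ` {(0, b), (c, d)}) (n - 1) =
    tree_count c (b - c) (d - b) (n - d)"
proof -
  have "card (cedge h n ` {..<n} \<union> chord h ` {(0, b), (c, d)}) = n + 2"
    using chorded_cycle_hamiltonian_graph[OF h cross] unfolding hamiltonian_graphs_def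
    by (simp only: mem_Collect_eq snd_conv)
  note trees = spanning_trees_chorded_cycle[OF h _ _ _ _ this]
  have "{0..<b} - {c..<d} = {0..<c}" "{0..<b} \<inter> {c..<d} = {c..<b}" "{c..<d} - {0..<b} = {b..<d}"
    "{..<n} - ({0..<b} \<union> {c..<d}) = {d..<n}"
    using cross by auto
  then show ?thesis
    using trees cross by (simp add: tree_count_def)
qed

text \<open>The vector \<open>y\<close> is a maximizer and \<open>M\<close> contains all of them.
  Comparison with the graph of vector \<open>y\<close> puts the class sizes of \<open>G\<close> into
  \<open>M\<close>; being positive, they force the chords to cross, and then they are the c-path
  lengths.\<close>

lemma most_reliable_type_A:
  fixes G :: "'a ugraph"
  assumes G: "uniformly_most_reliable n (n + 2) G"
    and y: "y1 + y2 + y3 + y4 = n" "y1 > 0" "y2 > 0" "y3 > 0" "y4 > 0"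
    and max: "\<And>x1 x2 x3 x4. x1 + x2 + x3 + x4 = n \<Longrightarrow>
      tree_count y1 y2 y3 y4 \<le> tree_count x1 x2 x3 x4 \<Longrightarrow> (x1, x2, x3, x4) \<in> M"
    and pos: "\<And>x1 x2 x3 x4. (x1, x2, x3, x4) \<in> M \<Longrightarrow> x1 > 0 \<and> x2 > 0 \<and> x3 > 0 \<and> x4 > 0"
  shows "\<exists>z\<in>M. graph_iso G (type_A z)"
proof -
  have Gham: "G \<in> hamiltonian_graphs n (n + 2)"
    using G unfolding uniformly_most_reliable_def by blast
  then obtain h b c d where h: "inj_on h {..<n}" and b: "0 < b" "b < n" and cd: "c < d" "d < n"
    and G_eq: "G = (h ` {..<n}, cedge h n ` {..<n} \<union> chord h ` {(0, b), (c, d)})"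
    by (rule hamiltonian_graph_chorded_cycle)
  let ?A = "{0..<b}" and ?B = "{c..<d}"
  define x1 x2 x3 x4 where x: "x1 = card (?A - ?B)" "x2 = card (?A \<inter> ?B)" "x3 = card (?B - ?A)"
    "x4 = card ({..<n} - (?A \<union> ?B))"
  have sub: "?A \<union> ?B \<subseteq> {..<n}" using b cd by auto
  have "x1 + x2 = card ?A" unfolding x using card_Int_Diff[of ?A ?B] by simp
  moreover have "card ?A + x3 = card (?A \<union> ?B)"
    unfolding x by (subst card_Un_disjoint[symmetric]) (auto simp: Un_Diff_cancel)
  moreover have "card (?A \<union> ?B) + x4 = n"
    unfolding x using card_Int_Diff[of "{..<n}" "?A \<union> ?B"] Int_absorb1[OF sub]
    by (simp only: finite_lessThan card_lessThan simp_thms)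
  ultimately have sum: "x1 + x2 + x3 + x4 = n" by simp
  have "card (cedge h n ` {..<n} \<union> chord h ` {(0, b), (c, d)}) = n + 2"
    using Gham unfolding hamiltonian_graphs_def G_eq by (simp only: mem_Collect_eq snd_conv)
  then have treesG: "connected_spanning G (n - 1) = tree_count x1 x2 x3 x4"
    using spanning_trees_chorded_cycle[OF h b cd] unfolding G_eq tree_count_def sum unfolding x
    by blast
  \<comment> \<open>The competitor is built on the vertices of \<open>G\<close> with the same
    numbering \<open>h\<close>, which makes it a graph over the type \<open>'a\<close>.\<close>
  define H where "H = (h ` {..<n}, cedge h n ` {..<n} \<union> chord h ` {(0, y1 + y2), (y1, y1 + y2 + y3)})"
  have cross: "0 < y1" "y1 < y1 + y2" "y1 + y2 < y1 + y2 + y3" "y1 + y2 + y3 < n" using y by auto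
  have Hham: "H \<in> hamiltonian_graphs n (n + 2)"
    unfolding H_def by (rule chorded_cycle_hamiltonian_graph[OF h cross])
  have "n - (y1 + y2 + y3) = y4" using y(1) by simp
  then have treesH: "connected_spanning H (n - 1) = tree_count y1 y2 y3 y4"
    unfolding H_def spanning_trees_crossing_chords[OF h cross] by simp
  have zero: "connected_spanning K i = 0"
    if "K \<in> hamiltonian_graphs n (n + 2)" "i < n - 1" for K :: "'a ugraph" and i
  proof (rule connected_spanning_eq_0)
    have "card (edges K) = n + 2" "card (verts K) = n"
      using that(1) unfolding hamiltonian_graphs_def by blast+
    then show "finite (edges K)" "Suc i < card (verts K)"
      using that(2) by (auto intro: card_ge_0_finite)
  qed
  have "connected_spanning H (n - 1) \<le> connected_spanning G (n - 1)"
  proof (rule connected_spanning_mono_of_Rel_le)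
    show "Rel H p \<le> Rel G p" if "0 \<le> p" "p \<le> 1" for p
      using G Hham that unfolding uniformly_most_reliable_def by simp
    show "card (edges H) = n + 2" "card (edges G) = n + 2"
      using Hham Gham unfolding hamiltonian_graphs_def by blast+
  qed (use zero Gham Hham in auto)
  then have M: "(x1, x2, x3, x4) \<in> M" using max[OF sum] unfolding treesG treesH by blast
  \<comment> \<open>An edge on both arcs gives \<open>c < b\<close>, an edge on the second arc only
    gives \<open>b < d\<close>, and then an edge on the first arc only gives
    \<open>0 < c\<close>.\<close>
  then have ne: "?A - ?B \<noteq> {}" "?A \<inter> ?B \<noteq> {}" "?B - ?A \<noteq> {}"
    using pos[OF M] unfolding x by force+
  then have cross': "0 < c" "c < b" "b < d"
  proof -
    from ne(2) show "c < b" by auto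
    from ne(3) show bd: "b < d" by auto
    from ne(1) bd show "0 < c" by (cases "c = 0") auto
  qed
  have "?A - ?B = {0..<c}" "?A \<inter> ?B = {c..<b}" "?B - ?A = {b..<d}"
    "{..<n} - (?A \<union> ?B) = {d..<n}"
    using cross' cd by auto
  then have "(x1, x2, x3, x4) = (c, b - c, d - b, n - d)" unfolding x by simp
  moreover have "graph_iso G (type_A (c, b - c, d - b, n - d))"
    unfolding G_eq by (rule graph_iso_chorded_cycle_type_A[OF h cross' cd(2)])
  ultimately show ?thesis using M by metis
qed

theorem theorem2:
  fixes G :: "'a ugraph" and n k \<alpha> :: nat
  assumes "n = 4 * k + \<alpha>"
    and "k > 0"
    and "\<alpha> \<in> {0, 1, 2, 3}"
    and "uniformly_most_reliable n (n + 2) G"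
  shows "(\<alpha> = 0 \<longrightarrow> graph_iso G (type_A (k, k, k, k))) \<and>
         (\<alpha> = 1 \<longrightarrow> graph_iso G (type_A (k + 1, k, k, k))) \<and>
         (\<alpha> = 2 \<longrightarrow> graph_iso G (type_A (k + 1, k, k + 1, k))) \<and>
         (\<alpha> = 3 \<longrightarrow> graph_iso G (type_A (k + 1, k + 1, k + 1, k)))"
proof (intro conjI impI)
  note G = assms(4)
  have k: "k \<ge> 1" using assms(2) by simp
  \<comment> \<open>All maximizers are rotations of the claimed vector, so repeated rotation reaches
    it from each of them. The first entry is always \<open>k\<close> or \<open>k + 1\<close>, hence
    the two instances used below.\<close>
  have rot: "graph_iso G (type_A (x2, x3, x4, x1))"
    if "graph_iso G (type_A (x1, x2, x3, x4))" "x1 > 0" for x1 x2 x3 x4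
    using graph_iso_trans[OF that(1) graph_iso_type_A_rotate] that(2) by simp
  show "graph_iso G (type_A (k, k, k, k))" if "\<alpha> = 0"
  proof -
    have "\<exists>z\<in>{(k, k, k, k)}. graph_iso G (type_A z)"
    proof (rule most_reliable_type_A[OF G, of k k k k])
      fix x1 x2 x3 x4
      assume "x1 + x2 + x3 + x4 = n" "tree_count k k k k \<le> tree_count x1 x2 x3 x4"
      then show "(x1, x2, x3, x4) \<in> {(k, k, k, k)}"
        using tree_count_maximal(1)[OF k, of x1 x2 x3 x4] assms(1) that by simp
    qed (use assms(1) that k in auto)
    then show ?thesis by simp
  qed
  show "graph_iso G (type_A (k + 1, k, k, k))" if "\<alpha> = 1"
  proof -
    have "\<exists>z\<in>{(k + 1, k, k, k), (k, k + 1, k, k), (k, k, k + 1, k), (k, k, k, k + 1)}.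
        graph_iso G (type_A z)"
    proof (rule most_reliable_type_A[OF G, of "k + 1" k k k])
      fix x1 x2 x3 x4
      assume "x1 + x2 + x3 + x4 = n" "tree_count (k + 1) k k k \<le> tree_count x1 x2 x3 x4"
      then show "(x1, x2, x3, x4) \<in>
          {(k + 1, k, k, k), (k, k + 1, k, k), (k, k, k + 1, k), (k, k, k, k + 1)}"
        using tree_count_maximal(2)[OF k, of x1 x2 x3 x4] assms(1) that by simp
    qed (use assms(1) that k in auto)
    then show ?thesis using rot[of k] rot[of "k + 1"] k by auto
  qed
  show "graph_iso G (type_A (k + 1, k, k + 1, k))" if "\<alpha> = 2"
  proof -
    have "\<exists>z\<in>{(k + 1, k, k + 1, k), (k, k + 1, k, k + 1)}. graph_iso G (type_A z)"
    proof (rule most_reliable_type_A[OF G, of "k + 1" k "k + 1" k])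
      fix x1 x2 x3 x4
      assume "x1 + x2 + x3 + x4 = n" "tree_count (k + 1) k (k + 1) k \<le> tree_count x1 x2 x3 x4"
      then show "(x1, x2, x3, x4) \<in> {(k + 1, k, k + 1, k), (k, k + 1, k, k + 1)}"
        using tree_count_maximal(3)[OF k, of x1 x2 x3 x4] assms(1) that by simp
    qed (use assms(1) that k in auto)
    then show ?thesis using rot[of k] rot[of "k + 1"] k by auto
  qed
  show "graph_iso G (type_A (k + 1, k + 1, k + 1, k))" if "\<alpha> = 3"
  proof -
    have "\<exists>z\<in>{(k, k + 1, k + 1, k + 1), (k + 1, k, k + 1, k + 1),
             (k + 1, k + 1, k, k + 1), (k + 1, k + 1, k + 1, k)}. graph_iso G (type_A z)"
    proof (rule most_reliable_type_A[OF G, of "k + 1" "k + 1" "k + 1" k])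
      fix x1 x2 x3 x4
      assume "x1 + x2 + x3 + x4 = n"
        "tree_count (k + 1) (k + 1) (k + 1) k \<le> tree_count x1 x2 x3 x4"
      then show "(x1, x2, x3, x4) \<in> {(k, k + 1, k + 1, k + 1), (k + 1, k, k + 1, k + 1),
             (k + 1, k + 1, k, k + 1), (k + 1, k + 1, k + 1, k)}"
        using tree_count_maximal(4)[OF k, of x1 x2 x3 x4] assms(1) that by simp
    qed (use assms(1) that k in auto)
    then show ?thesis using rot[of k] rot[of "k + 1"] k by auto
  qed
qed

end
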